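(* Let $n\ge 5$ be odd and $m=\frac{2^n+1}{3}$. Let $\ell\ge 1$ be such that $\rho_{\ell+1}=(0,1,k)$, i.e. $\rho_{\ell+1}=2m+8k$, for some integer $0\le k<m$. Then $$d_{ORD}(C_\ell(P_\infty))=\begin{cases} 2, & \text{if } k\le\lfloor\frac{m}{8}\rfloor,\\ 3, & \text{if } \lceil\frac{m}{8}\rceil\le k\le\lfloor\frac{m}{4}\rfloor,\\ 4, & \text{if } \lceil\frac{m}{4}\rceil\le k\le\lfloor\frac{3m}{8}\rfloor,\\ 5, & \text{if } \lceil\frac{3m}{8}\rceil\le k\le\lfloor\frac{m}{2}\rfloor,\\ 6, & \text{if } \lceil\frac{m}{2}\rceil\le k\le\lfloor\frac{5m}{8}\rfloor,\\ 8\left(\max\{0,\lceil k-\frac{7m}{8}\rceil\}+1\right), & \text{if } \lceil\frac{5m}{8}\rceil\le k\le m-1.\end{cases}$$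
   Context: Let $n\ge5$ be odd, $m=(2^n+1)/3$, and let $GGS(2,n)$ be (the nonsingular model of) the curve $X^2+X=Y^{3}$, $Y^{4}-Y=Z^m$; it is $\mathbb F_{2^{2n}}$-maximal of genus $g=\frac{9m-7}{2}$ and has a unique point at infinity $P_\infty$. The Weierstrass semigroup $H(P_\infty)$ (the set of $r\ge 0$ such that some rational function has pole divisor $rP_\infty$) is known to be $$H(P_\infty)=\{3im+2jm+8k \mid i\in\{0,1\},\ j\in\{0,1,2,3\},\ k\ge0\},$$ and each element has a unique such representation; $(i,j,k)$ denotes the element $3im+2jm+8k$. Write $H(P_\infty)=\{\rho_1=0<\rho_2<\rho_3<\cdots\}$. For $\ell\ge1$, $\nu_\ell$ is the number of ordered pairs $(a,b)\in H(P_\infty)\times H(P_\infty)$ with $a+b=\rho_{\ell+1}$. Let $\overline D$ be the sum of all $\mathbb F_{2^{2n}}$-rational points other than $P_\infty$, and $C_\ell(P_\infty)=C^\perp(\overline D,\rho_\ell P_\infty)$ the dual of the one-point AG code obtained by evaluating $\mathcal L(\rho_\ell P_\infty)$ at the points of $\overline D$. The order bound (Feng-Rao designed minimum distance) is $d_{ORD}(C_\ell(P_\infty))=\min\{\nu_r\mid r\ge\ell\}$. *)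

theory Defs
  imports Complex_Main "HOL-Library.Infinite_Set" "HOL-Computational_Algebra.Polynomial"
begin

section \<open>Places of a function field\<close>

text \<open>
  The function field of the curve is the whole type \<open>'f\<close>; its field of constants is a
  subset \<open>K\<close>. Finite fields of varying order \<open>2^(2n)\<close> are not types, hence the sets.
\<close>

definition is_subfield :: "'f::field set \<Rightarrow> bool" where
  "is_subfield L \<longleftrightarrow> 0 \<in> L \<and> 1 \<in> L \<and>
     (\<forall>a\<in>L. \<forall>b\<in>L. a + b \<in> L \<and> a - b \<in> L \<and> a * b \<in> L) \<and> (\<forall>a\<in>L. inverse a \<in> L)"

definition transcendental_over :: "'f::field set \<Rightarrow> 'f \<Rightarrow> bool" where
  "transcendental_over K t \<longleftrightarrow>
     (\<forall>p. (\<forall>i. coeff p i \<in> K) \<and> poly p t = 0 \<longrightarrow> p = 0)"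

text \<open>
  Points of the nonsingular model are places of the function field, and a place is
  represented by its valuation ring: \<open>f \<in> P\<close> means that \<open>f\<close> is regular at \<open>P\<close>,
  \<open>f \<notin> P\<close> that \<open>P\<close> is a pole of \<open>f\<close>.
\<close>

definition is_place :: "'f::field set \<Rightarrow> 'f set \<Rightarrow> bool" where
  "is_place K P \<longleftrightarrow> K \<subset> P \<and> P \<subset> UNIV \<and>
     (\<forall>a\<in>P. \<forall>b\<in>P. a + b \<in> P \<and> a - b \<in> P \<and> a * b \<in> P) \<and>
     (\<forall>a. a \<in> P \<or> inverse a \<in> P)"

definition unit_at :: "'f::field set \<Rightarrow> 'f \<Rightarrow> bool" where
  "unit_at P u \<longleftrightarrow> u \<noteq> 0 \<and> u \<in> P \<and> inverse u \<in> P"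

text \<open>A local parameter generates the maximal ideal, i.e. the ideal of non-units.\<close>

definition local_param :: "'f::field set \<Rightarrow> 'f \<Rightarrow> bool" where
  "local_param P t \<longleftrightarrow> {a \<in> P. \<not> unit_at P a} = {t * a | a. a \<in> P}"

text \<open>The normalized discrete valuation at \<open>P\<close>, for nonzero arguments only.\<close>

definition place_val :: "'f::field set \<Rightarrow> 'f \<Rightarrow> int" where
  "place_val P f = (THE k. \<exists>t u. local_param P t \<and> unit_at P u \<and> f = t powi k * u)"

text \<open>
  The pole divisor of \<open>f\<close> is \<open>rP\<close>: no poles away from \<open>P\<close>, and pole order \<open>r\<close> at \<open>P\<close>
  (order \<open>0\<close> if \<open>f\<close> is regular at \<open>P\<close>).
\<close>

definition has_pole_divisor :: "'f::field set \<Rightarrow> 'f \<Rightarrow> nat \<Rightarrow> 'f set \<Rightarrow> bool" where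
  "has_pole_divisor K f r P \<longleftrightarrow> f \<noteq> 0 \<and>
     (\<forall>Q. is_place K Q \<and> Q \<noteq> P \<longrightarrow> f \<in> Q) \<and> int r = max 0 (- place_val P f)"

definition weierstrass_semigroup :: "'f::field set \<Rightarrow> 'f set \<Rightarrow> nat set" where
  "weierstrass_semigroup K P = {r. \<exists>f. has_pole_divisor K f r P}"

section \<open>The curve\<close>

text \<open>
  \<open>'f\<close> is the function field \<open>K(x,y,z)\<close> of the curve over the field \<open>K\<close> with \<open>2^(2n)\<close>
  elements. The relations and the transcendence of \<open>z\<close> determine it up to isomorphism:
  every place at which \<open>z\<close> has a pole is totally ramified over \<open>K(z)\<close>, so the
  degree over \<open>K(z)\<close> is \<open>8\<close>.
\<close>

definition GGS_function_field ::
    "nat \<Rightarrow> 'f::field set \<Rightarrow> 'f \<Rightarrow> 'f \<Rightarrow> 'f \<Rightarrow> bool" where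
  "GGS_function_field n K x y z \<longleftrightarrow>
     is_subfield K \<and> finite K \<and> card K = 2 ^ (2 * n) \<and>
     transcendental_over K z \<and> is_subfield hull (K \<union> {x, y, z}) = UNIV \<and>
     x ^ 2 + x = y ^ 3 \<and> y ^ 4 - y = z ^ ((2 ^ n + 1) div 3)"

definition is_place_at_infinity ::
    "'f::field set \<Rightarrow> 'f \<Rightarrow> 'f \<Rightarrow> 'f \<Rightarrow> 'f set \<Rightarrow> bool" where
  "is_place_at_infinity K x y z P \<longleftrightarrow> is_place K P \<and> \<not> {x, y, z} \<subseteq> P"

section \<open>The order bound\<close>

text \<open>\<open>\<rho>\<close> is indexed from \<open>1\<close>, so that \<open>rho H 1\<close> is the least element of \<open>H\<close>.\<close>

definition rho :: "nat set \<Rightarrow> nat \<Rightarrow> nat" where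
  "rho H l = enumerate H (l - 1)"

definition nu :: "nat set \<Rightarrow> nat \<Rightarrow> nat" where
  "nu H l = card {(a, b). a \<in> H \<and> b \<in> H \<and> a + b = rho H (l + 1)}"

text \<open>
  The order bound of the dual code \<open>C\<^sub>l(P)\<close>; it depends on the code only through
  \<open>H(P)\<close> and \<open>l\<close>. The infimum of a nonempty set of natural numbers is its minimum.
\<close>

definition d_ORD :: "'f::field set \<Rightarrow> 'f set \<Rightarrow> nat \<Rightarrow> nat" where
  "d_ORD K P l = Inf {nu (weierstrass_semigroup K P) r | r. r \<ge> l}"

end

theory Submission
  imports Defs
begin

text \<open>
  With \<open>w = y\<^sup>2 + y\<close> the function field is a tower of three quadratic Artin-Schreier extensions of
  \<open>K(z)\<close>, given by \<open>w\<^sup>2 + w = z\<^sup>m\<close>, \<open>y\<^sup>2 + y = w\<close> and \<open>x\<^sup>2 + x = y\<^sup>3\<close>. Such an extension \<open>L(t)\<close> has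
  discriminant \<open>1\<close>: if \<open>a + b t\<close> is integral over a ring that is integrally closed in \<open>L\<close> and
  contains \<open>t\<^sup>2 + t\<close>, then so is its conjugate \<open>a + b + b t\<close>, and the difference \<open>b\<close> lies in
  the ring. Hence \<open>K[x, y, z]\<close> is integrally closed, and it is the ring of functions regular away
  from infinity.

  At a place at infinity \<open>x\<^sup>2 \<sim> y\<^sup>3\<close> and \<open>y\<^sup>4 \<sim> z\<^sup>m\<close> up to units. With \<open>t = z\<^sup>s / x\<close>, \<open>s = (3 m - 1) / 8\<close>,
  this gives \<open>z \<sim> 1 / t\<^sup>8\<close>, and \<open>y\<close>, \<open>w\<close>, \<open>x\<close> have orders \<open>-2m\<close>, \<open>-4m\<close>, \<open>-3m\<close>. In each layer
  of the tower the two summands of \<open>a + b t\<close> have orders that differ modulo a power of \<open>2\<close>, so the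
  order of the sum is the smaller one. Thus \<open>t\<close> is a uniformizer, the place is unique, and the
  semigroup consists of the numbers \<open>u m + 8 k\<close> with \<open>u = 3 i + 2 j\<close>.

  The eight multipliers \<open>u\<close> represent all classes modulo \<open>8\<close>, so the splittings of an element
  can be counted class by class. Each count is linear in \<open>k\<close> up to truncated terms, and the
  minimum is attained at \<open>3m\<close>, \<open>4m\<close>, \<open>5m\<close>, \<open>6m\<close>, \<open>7m\<close> or at some \<open>9m + 8k'\<close>.
\<close>

section \<open>Valuation rings\<close>

definition is_subring :: "'f::field set \<Rightarrow> bool" where
  "is_subring R \<longleftrightarrow> 0 \<in> R \<and> 1 \<in> R \<and>
     (\<forall>a\<in>R. \<forall>b\<in>R. a + b \<in> R \<and> a - b \<in> R \<and> a * b \<in> R)"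

text \<open>Unlike for \<open>is_place\<close>, the whole field counts as a valuation ring and no
  constants are prescribed.\<close>

definition val_ring :: "'f::field set \<Rightarrow> bool" where
  "val_ring V \<longleftrightarrow> is_subring V \<and> (\<forall>a. a \<in> V \<or> inverse a \<in> V)"

definition poly_over :: "'f::field set \<Rightarrow> 'f poly \<Rightarrow> bool" where
  "poly_over S p \<longleftrightarrow> (\<forall>i. coeff p i \<in> S)"

lemma is_subringD:
  assumes "is_subring R"
  shows "0 \<in> R" "1 \<in> R" "a \<in> R \<Longrightarrow> b \<in> R \<Longrightarrow> a + b \<in> R"
    "a \<in> R \<Longrightarrow> b \<in> R \<Longrightarrow> a - b \<in> R" "a \<in> R \<Longrightarrow> b \<in> R \<Longrightarrow> a * b \<in> R"
    "a \<in> R \<Longrightarrow> - a \<in> R" "a \<in> R \<Longrightarrow> a ^ i \<in> R"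
proof -
  have mult: "a \<in> R \<Longrightarrow> b \<in> R \<Longrightarrow> a * b \<in> R" for a b
    using assms by (auto simp: is_subring_def)
  then show "a \<in> R \<Longrightarrow> b \<in> R \<Longrightarrow> a * b \<in> R" .
  show "0 \<in> R" "1 \<in> R" "a \<in> R \<Longrightarrow> b \<in> R \<Longrightarrow> a + b \<in> R"
    "a \<in> R \<Longrightarrow> b \<in> R \<Longrightarrow> a - b \<in> R"
    using assms by (auto simp: is_subring_def)
  show "a \<in> R \<Longrightarrow> - a \<in> R"
    using assms unfolding is_subring_def by (metis diff_0)
  show "a \<in> R \<Longrightarrow> a ^ i \<in> R"
    using \<open>1 \<in> R\<close> by (induction i) (auto intro: mult)
qed

lemma is_subring_sum:
  assumes "is_subring R" "\<And>i. i \<in> I \<Longrightarrow> f i \<in> R"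
  shows "sum f I \<in> R"
  using assms(2)
  by (induction I rule: infinite_finite_induct) (auto intro: is_subringD[OF assms(1)])

lemma poly_over_simps:
  assumes "is_subring S"
  shows "poly_over S 0" "a \<in> S \<Longrightarrow> poly_over S (monom a i)"
    "poly_over S p \<Longrightarrow> poly_over S q \<Longrightarrow> poly_over S (p + q)"
    "poly_over S p \<Longrightarrow> poly_over S q \<Longrightarrow> poly_over S (p - q)"
    "poly_over S p \<Longrightarrow> poly_over S q \<Longrightarrow> poly_over S (p * q)"
    "a \<in> S \<Longrightarrow> poly_over S p \<Longrightarrow> poly_over S (smult a p)"
    "(\<And>i. i \<in> I \<Longrightarrow> poly_over S (f i)) \<Longrightarrow> poly_over S (sum f I)"
  using assms
  by (auto simp: poly_over_def is_subringD coeff_mult coeff_sum intro!: is_subring_sum)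

lemma poly_in_subring:
  assumes "is_subring S" "poly_over S p" "u \<in> S"
  shows "poly p u \<in> S"
  unfolding poly_altdef using assms
  by (intro is_subring_sum is_subringD) (auto simp: poly_over_def)

section \<open>Rings generated by one element\<close>

definition adjoin :: "'f::field set \<Rightarrow> 'f \<Rightarrow> 'f set" where
  "adjoin S u = {poly p u | p. poly_over S p}"

lemma adjoin:
  assumes "is_subring S"
  shows "is_subring (adjoin S u)" "S \<subseteq> adjoin S u" "u \<in> adjoin S u"
proof -
  note c = poly_over_simps[OF assms]
  show "S \<subseteq> adjoin S u"
    using c(2)[of _ 0] unfolding adjoin_def
    by (force simp: poly_monom intro!: exI[of _ "monom _ 0"])
  have "poly (monom 1 1) u = u" by (simp add: poly_monom)
  then show "u \<in> adjoin S u"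
    using c(2)[of 1 1] is_subringD(2)[OF assms] unfolding adjoin_def by force
  show "is_subring (adjoin S u)"
    unfolding is_subring_def
  proof (intro conjI ballI)
    show "0 \<in> adjoin S u" "1 \<in> adjoin S u"
      using \<open>S \<subseteq> adjoin S u\<close> is_subringD[OF assms] by auto
    fix a b assume "a \<in> adjoin S u" "b \<in> adjoin S u"
    then obtain p q where pq: "a = poly p u" "b = poly q u" "poly_over S p" "poly_over S q"
      unfolding adjoin_def by auto
    show "a + b \<in> adjoin S u" "a - b \<in> adjoin S u" "a * b \<in> adjoin S u"
      using c(3-5)[OF pq(3,4)] unfolding pq adjoin_def
      by (auto simp flip: poly_add poly_diff poly_mult)
  qed
qed

lemma adjoin_subset:
  assumes "is_subring T" "S \<subseteq> T" "u \<in> T"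
  shows "adjoin S u \<subseteq> T"
proof -
  have "poly p u \<in> T" if "poly_over S p" for p
    using that assms by (intro poly_in_subring) (auto simp: poly_over_def)
  then show ?thesis by (auto simp: adjoin_def)
qed

section \<open>Existence of valuation rings (Chevalley)\<close>

lemma is_subring_fractions:
  assumes "is_subring S" "d \<in> S" "d \<noteq> 0"
  shows "is_subring {s / d ^ i | s i. s \<in> S}"
  unfolding is_subring_def
proof (intro conjI ballI)
  note c = is_subringD[OF assms(1)]
  have "0 = 0 / d ^ 0" "1 = 1 / d ^ 0" by auto
  then show "0 \<in> {s / d ^ i | s i. s \<in> S}" "1 \<in> {s / d ^ i | s i. s \<in> S}"
    using c(1,2) by blast+
  fix a b assume "a \<in> {s / d ^ i | s i. s \<in> S}" "b \<in> {s / d ^ i | s i. s \<in> S}"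
  then obtain s i s' j where *: "a = s / d ^ i" "b = s' / d ^ j" "s \<in> S" "s' \<in> S" by auto
  have "a + b = (s * d ^ j + s' * d ^ i) / d ^ (i + j)"
       "a - b = (s * d ^ j - s' * d ^ i) / d ^ (i + j)"
       "a * b = (s * s') / d ^ (i + j)"
    using assms(3) by (auto simp: * field_simps power_add)
  moreover have "s * d ^ j + s' * d ^ i \<in> S" "s * d ^ j - s' * d ^ i \<in> S" "s * s' \<in> S"
    using * assms(2) by (auto intro!: c)
  ultimately show "a + b \<in> {s / d ^ i | s i. s \<in> S}" "a - b \<in> {s / d ^ i | s i. s \<in> S}"
       "a * b \<in> {s / d ^ i | s i. s \<in> S}"
    by blast+
qed

text \<open>\<open>units\<close> puts \<open>p\<close> into the Jacobson radical of
  \<open>S\<close>. Clearing denominators in \<open>p * poly q2 (inverse u) = 1\<close> writes a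
  power of \<open>u\<close> as \<open>p\<close> times a polynomial in \<open>u\<close> of smaller
  degree, which replaces the leading term of \<open>q1\<close>.\<close>

lemma reduce_degree:
  assumes S: "is_subring S" and "p \<in> S"
    and units: "\<And>c. c \<in> S \<Longrightarrow> 1 - p * c \<noteq> 0 \<and> inverse (1 - p * c) \<in> S"
    and "u \<noteq> 0" and q1: "poly_over S q1" "p * poly q1 u = 1"
    and q2: "poly_over S q2" "p * poly q2 (inverse u) = 1" and "degree q2 \<le> degree q1"
  shows "\<exists>q. poly_over S q \<and> p * poly q u = 1 \<and> degree q < degree q1"
proof -
  note c = is_subringD[OF S] and pc = poly_over_simps[OF S]
  let ?n = "degree q1"
  have co: "coeff q1 i \<in> S" "coeff q2 i \<in> S" for i using q1 q2 by (auto simp: poly_over_def)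
  have n: "?n > 0"
  proof (rule ccontr)
    assume "\<not> ?n > 0"
    then have "poly q1 u = coeff q1 0" by (simp add: poly_altdef)
    then show False using units[OF co(1)[of 0]] q1(2) by simp
  qed
  \<comment> \<open>The constant term of \<open>q2\<close> moves to the other side, where it leaves
    a unit \<open>e\<close> to divide by.\<close>
  define e where "e = 1 - p * coeff q2 0"
  have e: "e \<noteq> 0" "inverse e \<in> S" using units[OF co(2)] by (auto simp: e_def)
  define h where "h = (\<Sum>j=1..degree q2. monom (inverse e * coeff q2 j) (?n - j))"
  have h: "poly_over S h"
    unfolding h_def using e co by (intro pc c)
  have dh: "degree h < ?n"
    unfolding h_def using n
    by (intro degree_sum_less) (auto intro: le_less_trans[OF degree_monom_le])
  have "e * u ^ ?n = (p * poly q2 (inverse u) - p * coeff q2 0) * u ^ ?n"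
    using q2(2) by (simp add: e_def)
  also have "poly q2 (inverse u) = coeff q2 0 + (\<Sum>j=1..degree q2. coeff q2 j * inverse u ^ j)"
    unfolding poly_altdef by (simp add: sum.atMost_shift atMost_atLeast0 sum.atLeast_Suc_atMost)
  also have "(p * \<dots> - p * coeff q2 0) * u ^ ?n
      = p * (\<Sum>j=1..degree q2. coeff q2 j * (inverse u ^ j * u ^ ?n))"
    by (simp add: algebra_simps sum_distrib_left)
  also have "(\<Sum>j=1..degree q2. coeff q2 j * (inverse u ^ j * u ^ ?n))
      = (\<Sum>j=1..degree q2. coeff q2 j * u ^ (?n - j))"
    using \<open>u \<noteq> 0\<close> assms(9) by (intro sum.cong) (auto simp: power_diff field_simps)
  also have "\<dots> = e * poly h u"
    using e(1) by (simp add: h_def poly_sum poly_monom sum_distrib_left flip: mult.assoc)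
  finally have un: "u ^ ?n = p * poly h u" using e(1) by simp
  define a where "a = coeff q1 ?n"
  \<comment> \<open>The leading term \<open>a * u ^ ?n\<close> is traded for
    \<open>p * a * poly h u\<close>.\<close>
  define q where "q = (q1 - monom a ?n) + smult (p * a) h"
  have "poly q u = poly q1 u"
    by (simp add: q_def poly_monom un)
  moreover have "poly_over S q"
    unfolding q_def a_def using q1(1) h \<open>p \<in> S\<close> co by (intro pc c)
  moreover have "degree q < ?n"
  proof -
    have "degree (q1 - monom a ?n) \<le> ?n"
      by (intro degree_diff_le degree_monom_le) auto
    moreover have "coeff (q1 - monom a ?n) ?n = 0" by (simp add: a_def)
    ultimately have "degree (q1 - monom a ?n) < ?n"
      using n by (metis degree_0 leading_coeff_0_iff le_neq_implies_less)
    moreover have "degree (smult (p * a) h) < ?n"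
      using dh by (meson degree_smult_le le_less_trans)
    ultimately show ?thesis unfolding q_def by (rule degree_add_less)
  qed
  ultimately show ?thesis using q1(2) by auto
qed

text \<open>Infinite descent on the sum of the degrees, with \<open>u\<close> and
  \<open>inverse u\<close> exchanged when \<open>q2\<close> has the larger degree.\<close>

lemma no_inverse_pair:
  assumes S: "is_subring S" and "p \<in> S"
    and units: "\<And>c. c \<in> S \<Longrightarrow> 1 - p * c \<noteq> 0 \<and> inverse (1 - p * c) \<in> S"
    and "u \<noteq> 0" and "poly_over S q1" "p * poly q1 u = 1"
    and "poly_over S q2" "p * poly q2 (inverse u) = 1"
  shows False
  using assms(4-8)
proof (induction "degree q1 + degree q2" arbitrary: q1 q2 u rule: less_induct)
  case less
  note red = reduce_degree[OF S \<open>p \<in> S\<close> units]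
  show False
  proof (cases "degree q2 \<le> degree q1")
    case True
    obtain q where "poly_over S q" "p * poly q u = 1" "degree q < degree q1"
      using red[OF _ less.prems(1-5) True] by auto
    then show False using less.hyps[of q q2 u] less.prems by simp
  next
    case False
    then obtain q where "poly_over S q" "p * poly q (inverse u) = 1" "degree q < degree q2"
      using red[OF _ _ less.prems(4,5,2)] less.prems(1,3) by auto
    then show False using less.hyps[of q1 q u] less.prems by simp
  qed
qed

text \<open>A ring maximal among those above \<open>R\<close> that omit \<open>inverse p\<close> is
  a valuation ring: if it contained neither \<open>u\<close> nor \<open>inverse u\<close>, adjoining
  either one would produce \<open>inverse p\<close>, against \<open>no_inverse_pair\<close>.\<close>

lemma exists_val_ring:
  assumes R: "is_subring R" and "p \<in> R" "p \<noteq> 0" "inverse p \<notin> R"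
  shows "\<exists>V. val_ring V \<and> R \<subseteq> V \<and> inverse p \<notin> V"
proof -
  define \<A> where "\<A> = {S. is_subring S \<and> R \<subseteq> S \<and> inverse p \<notin> S}"
  have "\<exists>M\<in>\<A>. \<forall>X\<in>\<A>. M \<subseteq> X \<longrightarrow> X = M"
  proof (rule subset_Zorn_nonempty)
    show "\<A> \<noteq> {}" using assms by (auto simp: \<A>_def)
    fix C assume C: "C \<noteq> {}" "subset.chain \<A> C"
    have sub: "is_subring X" "R \<subseteq> X" "inverse p \<notin> X" if "X \<in> C" for X
      using that C(2) by (auto simp: subset_chain_def \<A>_def)
    have common: "\<exists>X\<in>C. a \<in> X \<and> b \<in> X" if "a \<in> \<Union>C" "b \<in> \<Union>C" for a b
      using that C(2) unfolding subset_chain_def by blast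
    have "is_subring (\<Union>C)"
      unfolding is_subring_def
    proof (intro conjI ballI)
      show "0 \<in> \<Union>C" "1 \<in> \<Union>C" using C(1) sub(1) is_subringD(1,2) by blast+
      fix a b assume "a \<in> \<Union>C" "b \<in> \<Union>C"
      from common[OF this] obtain X where "X \<in> C" "a \<in> X" "b \<in> X" by auto
      then show "a + b \<in> \<Union>C" "a - b \<in> \<Union>C" "a * b \<in> \<Union>C"
        using sub(1) is_subringD(3-5) by blast+
    qed
    then show "\<Union>C \<in> \<A>" using C(1) sub unfolding \<A>_def by blast
  qed
  then obtain S where S: "is_subring S" "R \<subseteq> S" "inverse p \<notin> S"
    and "\<forall>X\<in>\<A>. S \<subseteq> X \<longrightarrow> X = S" by (auto simp: \<A>_def)
  then have max: "inverse p \<in> T" if "is_subring T" "S \<subseteq> T" "x \<in> T" "x \<notin> S" for T x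
    using that by (auto simp: \<A>_def)
  note c = is_subringD[OF S(1)]
  have "p \<in> S" using S assms by auto
  \<comment> \<open>If \<open>d = 1 - p * b\<close> had no inverse in \<open>S\<close>, the
    fractions over powers of \<open>d\<close> would contain \<open>inverse p\<close>; since
    \<open>d ^ i\<close> is \<open>1\<close> modulo \<open>p\<close>, this would put
    \<open>inverse p\<close> into \<open>S\<close>.\<close>
  have units: "1 - p * b \<noteq> 0 \<and> inverse (1 - p * b) \<in> S" if "b \<in> S" for b
  proof
    define d where "d = 1 - p * b"
    show "1 - p * b \<noteq> 0"
      using \<open>p \<noteq> 0\<close> that S(3) inverse_unique[of p b] by auto
    then have "d \<noteq> 0" by (simp add: d_def)
    have dS: "d \<in> S" unfolding d_def using that \<open>p \<in> S\<close> by (intro c)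
    have dpow: "\<exists>b'\<in>S. d ^ i = 1 - p * b'" for i
    proof (induction i)
      case (Suc i)
      then obtain b' where "b' \<in> S" "d ^ i = 1 - p * b'" by auto
      then have "d ^ Suc i = d * (1 - p * b')"
        by simp
      also have "\<dots> = 1 - p * (b' + b - p * b * b')"
        by (simp add: d_def algebra_simps)
      finally have "d ^ Suc i = 1 - p * (b' + b - p * b * b')" .
      moreover have "b' + b - p * b * b' \<in> S"
        using \<open>b' \<in> S\<close> that \<open>p \<in> S\<close> by (intro c)
      ultimately show ?case by blast
    qed (auto intro!: bexI[of _ 0] c)
    let ?T = "{s / d ^ i | s i. s \<in> S}"
    show "inverse (1 - p * b) \<in> S"
    proof (rule ccontr)
      assume "inverse (1 - p * b) \<notin> S"
      moreover have "inverse (1 - p * b) = 1 / d ^ 1" by (simp add: d_def field_simps)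
      moreover have "s = s / d ^ 0" for s by simp
      ultimately have "inverse p \<in> ?T"
        using c(2) by (intro max[OF is_subring_fractions[OF S(1) dS \<open>d \<noteq> 0\<close>]]) blast+
      then obtain s i where s: "s \<in> S" "inverse p = s / d ^ i" by auto
      obtain b' where b': "b' \<in> S" "d ^ i = 1 - p * b'" using dpow by auto
      have "p * (s + b') = 1"
        using s(2) b'(2) \<open>p \<noteq> 0\<close> \<open>d \<noteq> 0\<close> by (auto simp: field_simps)
      then have "inverse p = s + b'" by (rule inverse_unique)
      then show False using S(3) s b' c(3) by auto
    qed
  qed
  have adj: "\<exists>q. poly_over S q \<and> p * poly q u = 1" if "u \<notin> S" for u
  proof -
    have "inverse p \<in> adjoin S u"
      by (rule max[OF _ _ _ that]) (use adjoin[OF S(1)] in auto)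
    then show ?thesis using \<open>p \<noteq> 0\<close> unfolding adjoin_def by (auto simp: field_simps)
  qed
  have "u \<in> S \<or> inverse u \<in> S" for u
  proof (rule ccontr)
    assume u: "\<not> (u \<in> S \<or> inverse u \<in> S)"
    then have "u \<noteq> 0" using c(1) by auto
    then show False
      using adj[of u] adj[of "inverse u"] u no_inverse_pair[OF S(1) \<open>p \<in> S\<close> units] by blast
  qed
  then show ?thesis using S by (auto simp: val_ring_def)
qed

text \<open>Otherwise some valuation ring above \<open>R[1/f]\<close> omits \<open>f\<close>. The
  conclusion is the classical integral equation of \<open>f\<close> over \<open>R\<close>, divided
  by a power of \<open>f\<close>.\<close>

lemma val_ring_adjoin_inverse:
  assumes "is_subring R" "f \<noteq> 0" "\<And>V. val_ring V \<Longrightarrow> R \<subseteq> V \<Longrightarrow> f \<in> V"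
  shows "f \<in> adjoin R (inverse f)"
  using exists_val_ring[of "adjoin R (inverse f)" "inverse f"] assms adjoin[of R "inverse f"]
  by (metis inverse_inverse_eq inverse_nonzero_iff_nonzero subset_trans)

text \<open>The integral closure of a ring is the intersection of the valuation rings above it.\<close>

definition integrally_closed_in :: "'f::field set \<Rightarrow> 'f set \<Rightarrow> bool" where
  "integrally_closed_in R L \<longleftrightarrow> (\<forall>b\<in>L. (\<forall>V. val_ring V \<and> R \<subseteq> V \<longrightarrow> b \<in> V) \<longrightarrow> b \<in> R)"

section \<open>Artin-Schreier extensions\<close>

text \<open>For a subring \<open>R\<close> that contains \<open>t^2 + t\<close>, this is the ring
  \<open>R[t]\<close>.\<close>

definition qext :: "'f::field set \<Rightarrow> 'f \<Rightarrow> 'f set" where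
  "qext L t = {a + b * t | a b. a \<in> L \<and> b \<in> L}"

lemma is_subfieldD:
  assumes "is_subfield L"
  shows "is_subring L" "a \<in> L \<Longrightarrow> inverse a \<in> L" "a \<in> L \<Longrightarrow> b \<in> L \<Longrightarrow> a / b \<in> L"
  using assms by (auto simp: is_subfield_def is_subring_def divide_inverse)

lemma qext_superset:
  assumes "is_subring R"
  shows "R \<subseteq> qext R t" "t \<in> qext R t"
proof -
  note c = is_subringD(1,2)[OF assms]
  have "a = a + 0 * t" "t = 0 + 1 * t" for a by auto
  then show "R \<subseteq> qext R t" "t \<in> qext R t" unfolding qext_def using c by blast+
qed

lemma qext_subset:
  assumes "is_subring T" "R \<subseteq> T" "t \<in> T"
  shows "qext R t \<subseteq> T"
  unfolding qext_def using is_subringD(3,5)[OF assms(1)] assms(2,3) by blast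

lemma qext_mult_eq:
  fixes t :: "'f::field"
  assumes "r = t\<^sup>2 + t"
  shows "(a + b * t) * (c + d * t) = (a * c + b * d * r) + (a * d + b * c - b * d) * t"
  unfolding assms by (simp add: algebra_simps power2_eq_square)

lemma is_subring_qext:
  assumes "is_subring R" "t\<^sup>2 + t \<in> R"
  shows "is_subring (qext R t)"
  unfolding is_subring_def
proof (intro conjI ballI)
  note c = is_subringD[OF assms(1)]
  show "0 \<in> qext R t" "1 \<in> qext R t" using qext_superset[OF assms(1)] c by auto
  fix x y assume "x \<in> qext R t" "y \<in> qext R t"
  then obtain a b a' b' where *: "x = a + b * t" "y = a' + b' * t"
    "a \<in> R" "b \<in> R" "a' \<in> R" "b' \<in> R" by (auto simp: qext_def)
  have "x + y = (a + a') + (b + b') * t" "x - y = (a - a') + (b - b') * t"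
    by (simp_all add: * algebra_simps)
  moreover have "a + a' \<in> R" "b + b' \<in> R" "a - a' \<in> R" "b - b' \<in> R" using * by (auto intro: c)
  ultimately show "x + y \<in> qext R t" "x - y \<in> qext R t" unfolding qext_def by blast+
  have "a * a' + b * b' * (t\<^sup>2 + t) \<in> R" "a * b' + b * a' - b * b' \<in> R"
    using * assms(2) by (auto intro!: c)
  then show "x * y \<in> qext R t"
    unfolding * qext_mult_eq[OF refl] unfolding qext_def by blast
qed

lemma qext_unique:
  assumes "is_subfield L" "t \<notin> L" "a + b * t = a' + b' * t"
    and "a \<in> L" "b \<in> L" "a' \<in> L" "b' \<in> L"
  shows "a = a'" "b = b'"
proof -
  note c = is_subfieldD[OF assms(1)]
  show "b = b'"
  proof (rule ccontr)
    assume "b \<noteq> b'"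
    then have "t = (a' - a) / (b - b')" using assms(3) by (simp add: field_simps)
    then show False using assms(2,4-) c is_subringD[OF c(1)] by auto
  qed
  then show "a = a'" using assms(3) by simp
qed

text \<open>The roots of \<open>X^2 + X = t^2 + t\<close> are \<open>t\<close> and
  \<open>t + 1\<close>. The conjugation that exchanges them appears only in coordinates:
  \<open>a + b * t\<close> becomes \<open>a + b + b * t\<close>.\<close>

locale artin_schreier =
  fixes L :: "'f::field set" and t :: 'f
  assumes char2: "1 + 1 = (0::'f)" and L: "is_subfield L" and t: "t \<notin> L" "t\<^sup>2 + t \<in> L"
begin

lemma add_self: "a + a = (0::'f)"
  using char2 by (metis distrib_left mult.right_neutral mult_zero_right)

lemmas Lc = is_subfieldD[OF L] is_subringD[OF is_subfieldD(1)[OF L]]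

text \<open>This is the norm from \<open>L(t)\<close> to \<open>L\<close>; the coefficient of
  \<open>t\<close> is \<open>a * b + a * b\<close>, which vanishes in characteristic 2.\<close>

lemma conj_norm:
  "(a + b * t) * (a + b + b * t) = a * a + a * b + b * b * (t\<^sup>2 + t)"
proof -
  have "a * b + b * (a + b) - b * b = a * b + a * b" by (simp add: algebra_simps)
  then show ?thesis
    unfolding qext_mult_eq[OF refl] by (simp only: add_self) (simp add: algebra_simps)
qed

lemma norm_nonzero:
  assumes "a \<in> L" "b \<in> L" "a + b * t \<noteq> 0"
  shows "a + b + b * t \<noteq> 0"
proof
  assume "a + b + b * t = 0"
  then have "a + b = 0" "b = 0"
    using qext_unique[OF L t(1), of "a + b" b 0 0] assms Lc by auto
  then show False using assms by simp
qed

text \<open>The inverse is the conjugate divided by the norm. An element and its conjugate have the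
  same norm, so inversion commutes with conjugation.\<close>

lemma inverse_qext:
  assumes "a \<in> L" "b \<in> L" "a + b * t \<noteq> 0"
  shows "\<exists>a'\<in>L. \<exists>b'\<in>L. inverse (a + b * t) = a' + b' * t \<and>
    inverse (a + b + b * t) = a' + b' + b' * t"
proof -
  define N where "N = (a + b * t) * (a + b + b * t)"
  have N: "N \<noteq> 0" using assms(3) norm_nonzero[OF assms] by (simp add: N_def)
  have "N \<in> L" unfolding N_def conj_norm
    by (rule Lc, rule Lc) (use assms t(2) Lc in auto)
  have "(a + b) / N + b / N * t = (a + b + b * t) / N"
    by (simp add: add_divide_distrib)
  also have "\<dots> = inverse (a + b * t)"
    using N unfolding N_def by (simp add: divide_inverse)
  finally have "inverse (a + b * t) = (a + b) / N + b / N * t" ..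
  moreover have "inverse (a + b + b * t) = (a + b) / N + b / N + b / N * t"
  proof -
    have "(a + b) / N + b / N + b / N * t = (a + (b + b) + b * t) / N"
      by (simp add: add_divide_distrib)
    also have "\<dots> = (a + b * t) / N" by (simp add: add_self)
    also have "\<dots> = inverse (a + b + b * t)"
      using N unfolding N_def by (simp add: divide_inverse)
    finally show ?thesis by simp
  qed
  moreover have "(a + b) / N \<in> L" "b / N \<in> L" using assms \<open>N \<in> L\<close> by (auto intro: Lc)
  ultimately show ?thesis by blast
qed

lemma is_subfield_qext: "is_subfield (qext L t)"
proof -
  have "inverse x \<in> qext L t" if "x \<in> qext L t" for x
  proof (cases "x = 0")
    case True
    then show ?thesis using that by simp
  next
    case False
    then show ?thesis using that inverse_qext by (fastforce simp: qext_def)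
  qed
  then show ?thesis
    using is_subring_qext[OF Lc(1) t(2)] by (auto simp: is_subfield_def is_subring_def)
qed

section \<open>Integral elements and their conjugates\<close>

lemma val_ring_t:
  assumes "val_ring V" "t\<^sup>2 + t \<in> V"
  shows "t \<in> V"
proof (rule ccontr)
  assume "t \<notin> V"
  then have "inverse t \<in> V" "t \<noteq> 0"
    using assms is_subringD(1)[of V] by (auto simp: val_ring_def)
  moreover have "t = (t\<^sup>2 + t) * inverse t - 1"
    using \<open>t \<noteq> 0\<close> by (simp add: field_simps power2_eq_square)
  ultimately show False
    using \<open>t \<notin> V\<close> assms unfolding val_ring_def by (metis is_subringD(2,4,5))
qed

text \<open>Integrality of \<open>f\<close> amounts to membership of \<open>f\<close> in
  \<open>R[t][1/f]\<close>. Conjugation maps \<open>R[t]\<close> to itself and carries this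
  membership to \<open>g\<close> in \<open>R[t][1/g]\<close> for the conjugate \<open>g\<close>,
  which is therefore integral too.\<close>

lemma integral_conj:
  assumes R: "is_subring R" "R \<subseteq> L" "t\<^sup>2 + t \<in> R" and ab: "a \<in> L" "b \<in> L"
    and integral: "\<And>V. val_ring V \<Longrightarrow> R \<subseteq> V \<Longrightarrow> a + b * t \<in> V"
    and V: "val_ring V" "R \<subseteq> V"
  shows "a + b + b * t \<in> V"
proof (cases "a + b * t = 0")
  case True
  then have "a = 0" "b = 0" using qext_unique[OF L t(1), of a b 0 0] ab Lc by auto
  then show ?thesis using V is_subringD(1) by (auto simp: val_ring_def)
next
  case False
  define f g where "f = a + b * t" and "g = a + b + b * t"
  have R': "is_subring (qext R t)" by (rule is_subring_qext) fact+
  have RR': "R \<subseteq> qext R t" "t \<in> qext R t" using qext_superset R(1) by auto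
  have "f \<in> adjoin (qext R t) (inverse f)"
    using RR' integral False by (intro val_ring_adjoin_inverse R') (auto simp: f_def)
  define W where "W = adjoin (qext R t) (inverse g)"
  note W = adjoin[OF R', of "inverse g", folded W_def]
  note Wc = is_subringD[OF W(1)]
  \<comment> \<open>\<open>T\<close> is the preimage of \<open>W\<close> under the conjugation \<open>t \<mapsto> t + 1\<close> of \<open>L(t)\<close> over \<open>L\<close>.\<close>
  define T where "T = {a + b * t | a b. a \<in> L \<and> b \<in> L \<and> a + b + b * t \<in> W}"
  have T: "a + b * t \<in> T" if "a \<in> L" "b \<in> L" "a + b + b * t \<in> W" for a b
    using that unfolding T_def by blast
  have "is_subring T"
    unfolding is_subring_def
  proof (intro conjI ballI)
    show "0 \<in> T" "1 \<in> T" using T[of 0 0] T[of 1 0] Wc Lc by auto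
    fix x y assume "x \<in> T" "y \<in> T"
    then obtain a b c d where *: "x = a + b * t" "y = c + d * t" "a \<in> L" "b \<in> L"
      "c \<in> L" "d \<in> L" "a + b + b * t \<in> W" "c + d + d * t \<in> W" by (auto simp: T_def)
    have "(a + c) + (b + d) * t \<in> T"
      by (rule T) (use * Lc Wc(3)[OF *(7,8)] in \<open>auto simp: algebra_simps\<close>)
    then show "x + y \<in> T" by (simp add: * algebra_simps)
    have "(a - c) + (b - d) * t \<in> T"
      by (rule T) (use * Lc Wc(4)[OF *(7,8)] in \<open>auto simp: algebra_simps\<close>)
    then show "x - y \<in> T" by (simp add: * algebra_simps)
    let ?r = "t\<^sup>2 + t"
    have "(a * c + b * d * ?r) + (a * d + b * c - b * d) * t \<in> T"
    proof (rule T)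
      show "a * c + b * d * ?r \<in> L" "a * d + b * c - b * d \<in> L"
        using * t(2) by (auto intro!: Lc)
      have "(a + b + b * t) * (c + d + d * t)
          = ((a + b) * (c + d) + b * d * ?r) + ((a + b) * d + b * (c + d) - b * d) * t"
        by (rule qext_mult_eq[OF refl])
      also have "(a + b) * (c + d) = a * c + (a * d + b * c - b * d) + (b * d + b * d)"
        by (simp add: algebra_simps)
      also have "(a + b) * d + b * (c + d) - b * d = (a * d + b * c - b * d) + (b * d + b * d)"
        by (simp add: algebra_simps)
      finally have "(a + b + b * t) * (c + d + d * t) =
          a * c + b * d * ?r + (a * d + b * c - b * d) + (a * d + b * c - b * d) * t"
        by (simp add: add_self)
      then show "a * c + b * d * ?r + (a * d + b * c - b * d) + (a * d + b * c - b * d) * t \<in> W"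
        using Wc(5)[OF *(7,8)] by simp
    qed
    then show "x * y \<in> T" unfolding * qext_mult_eq[OF refl] .
  qed
  moreover have "qext R t \<subseteq> T"
  proof
    fix x assume "x \<in> qext R t"
    then obtain c d where cd: "x = c + d * t" "c \<in> R" "d \<in> R" by (auto simp: qext_def)
    have "c \<in> W" "d \<in> W" "t \<in> W" using cd RR' W by auto
    then have "c + d + d * t \<in> W" by (auto intro!: Wc)
    then show "x \<in> T" using T cd R(2) by auto
  qed
  moreover have "inverse f \<in> T"
  proof -
    obtain a' b' where *: "a' \<in> L" "b' \<in> L" "inverse f = a' + b' * t" "inverse g = a' + b' + b' * t"
      using inverse_qext[OF ab False] unfolding f_def g_def by blast
    then show ?thesis using T W by metis
  qed
  ultimately have "f \<in> T"
    using adjoin_subset \<open>f \<in> adjoin (qext R t) (inverse f)\<close> by blast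
  then obtain a' b' where *: "a' \<in> L" "b' \<in> L" "f = a' + b' * t" "a' + b' + b' * t \<in> W"
    by (auto simp: T_def)
  then have "a' = a" "b' = b"
    using qext_unique[OF L t(1), of a b a' b'] ab by (auto simp: f_def)
  then have "g \<in> W" using * by (simp add: g_def)
  have "t \<in> V" using V R(3) by (intro val_ring_t) auto
  then have V': "qext R t \<subseteq> V" using V by (intro qext_subset) (auto simp: val_ring_def)
  have "g \<in> V"
  proof (rule ccontr)
    assume "g \<notin> V"
    then have "inverse g \<in> V" using V(1) by (auto simp: val_ring_def)
    then have "W \<subseteq> V" unfolding W_def using V V' by (intro adjoin_subset) (auto simp: val_ring_def)
    then show False using \<open>g \<in> W\<close> \<open>g \<notin> V\<close> by auto
  qed
  then show ?thesis by (simp add: g_def)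
qed

lemma integrally_closed_in_qext:
  assumes R: "is_subring R" "R \<subseteq> L" "t\<^sup>2 + t \<in> R" "integrally_closed_in R L"
  shows "integrally_closed_in (qext R t) (qext L t)"
  unfolding integrally_closed_in_def
proof (intro ballI impI)
  fix f assume "f \<in> qext L t" and f: "\<forall>V. val_ring V \<and> qext R t \<subseteq> V \<longrightarrow> f \<in> V"
  then obtain a b where ab: "f = a + b * t" "a \<in> L" "b \<in> L" by (auto simp: qext_def)
  have tV: "t \<in> V" if "val_ring V" "R \<subseteq> V" for V
    using that R(3) by (intro val_ring_t) auto
  have fV: "a + b * t \<in> V" if "val_ring V" "R \<subseteq> V" for V
    using f ab(1) that tV[OF that] qext_subset[of V R t] by (auto simp: val_ring_def)
  have "b \<in> V" if V: "val_ring V" "R \<subseteq> V" for V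
  proof -
    have "(a + b + b * t) - (a + b * t) \<in> V"
      using integral_conj[OF R(1-3) ab(2,3) fV V] fV[OF V] V(1) is_subringD(4)
      by (auto simp only: val_ring_def)
    then show ?thesis by simp
  qed
  then have b: "b \<in> R" using R(4) ab by (auto simp: integrally_closed_in_def)
  have "a \<in> V" if V: "val_ring V" "R \<subseteq> V" for V
  proof -
    have "(a + b * t) - b * t \<in> V"
      using fV[OF V] tV[OF V] b V is_subringD(4,5)[of V] unfolding val_ring_def by blast
    then show ?thesis by simp
  qed
  then have "a \<in> R" using R(4) ab by (auto simp: integrally_closed_in_def)
  then show "f \<in> qext R t" using b ab(1) by (auto simp: qext_def)
qed

end

section \<open>The rational function field\<close>

definition ratfun :: "'f::field set \<Rightarrow> 'f \<Rightarrow> 'f set" where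
  "ratfun K z = {a / b | a b. a \<in> adjoin K z \<and> b \<in> adjoin K z \<and> b \<noteq> 0}"

lemma is_subfield_ratfun:
  fixes K :: "'f::field set"
  assumes "is_subring K"
  shows "is_subfield (ratfun K z)" "adjoin K z \<subseteq> ratfun K z"
proof -
  note c = is_subringD[OF adjoin(1)[OF assms, of z]]
  show sub: "adjoin K z \<subseteq> ratfun K z"
  proof
    fix a assume "a \<in> adjoin K z"
    moreover have "a = a / 1" "(1::'f) \<noteq> 0" by auto
    ultimately show "a \<in> ratfun K z" unfolding ratfun_def using c(2) by blast
  qed
  show "is_subfield (ratfun K z)"
    unfolding is_subfield_def
  proof (intro conjI ballI)
    show "0 \<in> ratfun K z" "1 \<in> ratfun K z" using c sub by auto
    fix x y assume "x \<in> ratfun K z" "y \<in> ratfun K z"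
    then obtain a b a' b' where *: "x = a / b" "y = a' / b'" "a \<in> adjoin K z" "b \<in> adjoin K z"
      "a' \<in> adjoin K z" "b' \<in> adjoin K z" "b \<noteq> 0" "b' \<noteq> 0" by (auto simp: ratfun_def)
    have "x + y = (a * b' + a' * b) / (b * b')" "x - y = (a * b' - a' * b) / (b * b')"
      "x * y = (a * a') / (b * b')" "b * b' \<noteq> 0" using * by (auto simp: field_simps)
    moreover have "a * b' + a' * b \<in> adjoin K z" "a * b' - a' * b \<in> adjoin K z"
      "a * a' \<in> adjoin K z" "b * b' \<in> adjoin K z" using * by (auto intro!: c)
    ultimately show "x + y \<in> ratfun K z" "x - y \<in> ratfun K z" "x * y \<in> ratfun K z"
      unfolding ratfun_def by blast+
  next
    fix x assume "x \<in> ratfun K z"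
    then obtain a b where *: "x = a / b" "a \<in> adjoin K z" "b \<in> adjoin K z" "b \<noteq> 0"
      by (auto simp: ratfun_def)
    show "inverse x \<in> ratfun K z"
    proof (cases "a = 0")
      case True
      then show ?thesis using * sub c by auto
    next
      case False
      then have "inverse x = b / a" using * by simp
      then show ?thesis using * False unfolding ratfun_def by blast
    qed
  qed
qed

text \<open>\<open>K\<close> is a set and not a type, so the division algorithm is run with all
  coefficients kept in \<open>K\<close>.\<close>

lemma poly_over_divmod:
  assumes K: "is_subfield K" and g: "poly_over K g" "g \<noteq> 0" and f: "poly_over K f"
  shows "\<exists>s r. poly_over K s \<and> poly_over K r \<and> f = g * s + r \<and> (r = 0 \<or> degree r < degree g)"
  using f
\<comment> \<open>The measure separates \<open>0\<close> from the nonzero constants, so that it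
  still decreases when a constant is cancelled.\<close>
proof (induction "if f = 0 then 0 else Suc (degree f)" arbitrary: f rule: less_induct)
  case less
  note pc = poly_over_simps[OF is_subfieldD(1)[OF K]]
  show ?case
  proof (cases "f = 0 \<or> degree f < degree g")
    case True
    then show ?thesis using less.prems pc(1) by (intro exI[of _ 0] exI[of _ f]) auto
  next
    case False
    define h where "h = monom (lead_coeff f / lead_coeff g) (degree f - degree g)"
    have h: "poly_over K h"
      unfolding h_def using g(1) less.prems
      by (intro pc is_subfieldD(3)[OF K]) (auto simp: poly_over_def)
    have h0: "h \<noteq> 0" using False g by (simp add: h_def)
    have dh: "degree h = degree f - degree g" unfolding h_def using False g by (intro degree_monom_eq) auto
    have deg: "degree (g * h) = degree f"
      using h0 g(2) False by (simp add: degree_mult_eq dh)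
    have "lead_coeff h = lead_coeff f / lead_coeff g"
      unfolding h_def by (rule lead_coeff_monom)
    then have "lead_coeff (g * h) = lead_coeff f"
      using g(2) by (simp add: lead_coeff_mult)
    then have "coeff (g * h) (degree f) = coeff f (degree f)" by (simp only: deg)
    then have "coeff (f - g * h) (degree f) = 0" by (simp only: coeff_diff diff_self)
    moreover have "degree (f - g * h) \<le> degree f" using deg by (intro degree_diff_le) auto
    ultimately have "f - g * h = 0 \<or> degree (f - g * h) < degree f"
      by (metis leading_coeff_0_iff le_neq_implies_less)
    then have "\<exists>s r. poly_over K s \<and> poly_over K r \<and> f - g * h = g * s + r \<and>
      (r = 0 \<or> degree r < degree g)"
      using False by (intro less.hyps) (auto intro!: pc h less.prems g)
    then obtain s r where *: "poly_over K s" "poly_over K r" "f - g * h = g * s + r"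
      "r = 0 \<or> degree r < degree g" by blast
    have "f = g * (s + h) + r" using *(3) by (simp add: algebra_simps)
    then show ?thesis using * pc(3)[OF *(1) h] by blast
  qed
qed

text \<open>With \<open>b = p / q\<close> in lowest terms, Bezout expresses \<open>1 / q\<close>
  through \<open>b\<close> over \<open>K[z]\<close>. Hence \<open>1 / q\<close> lies in every
  valuation ring above \<open>K[z]\<close>, and so in \<open>K[z]\<close> by
  \<open>exists_val_ring\<close>.\<close>

lemma integrally_closed_in_ratfun:
  assumes K: "is_subfield K" and z: "transcendental_over K z"
  shows "integrally_closed_in (adjoin K z) (ratfun K z)"
  unfolding integrally_closed_in_def
proof (intro ballI impI)
  note Ks = is_subfieldD(1)[OF K] and pc = poly_over_simps[OF is_subfieldD(1)[OF K]]
  note Ac = is_subringD[OF adjoin(1)[OF Ks, of z]]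
  have nz: "poly p z \<noteq> 0" if "poly_over K p" "p \<noteq> 0" for p
    using z that by (auto simp: transcendental_over_def poly_over_def)
  have inA: "poly p z \<in> adjoin K z" if "poly_over K p" for p
    using that by (auto simp: adjoin_def)
  fix b assume "b \<in> ratfun K z" and b: "\<forall>V. val_ring V \<and> adjoin K z \<subseteq> V \<longrightarrow> b \<in> V"
  \<comment> \<open>The denominators of \<open>b\<close>; one of least degree gives lowest
    terms.\<close>
  define D where "D q \<longleftrightarrow> poly_over K q \<and> q \<noteq> 0 \<and> (\<exists>p. poly_over K p \<and> poly q z * b = poly p z)" for q
  have "\<exists>q. D q"
    using \<open>b \<in> ratfun K z\<close> unfolding ratfun_def adjoin_def D_def by fastforce
  then obtain q where q: "D q" "\<And>q'. D q' \<Longrightarrow> degree q \<le> degree q'"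
    using ex_has_least_nat[of D _ degree] by blast
  then obtain p where p: "poly_over K p" "poly q z * b = poly p z" and q': "poly_over K q" "q \<noteq> 0"
    by (auto simp: D_def)
  \<comment> \<open>The ideal generated by \<open>q\<close> and \<open>p\<close>. A nonzero element
    of least degree generates it, so it is their gcd.\<close>
  define J where "J h \<longleftrightarrow> poly_over K h \<and> (\<exists>u v. poly_over K u \<and> poly_over K v \<and> h = u * q + v * p)" for h
  have one: "poly_over K 1" using pc(2)[of 1 0] is_subringD(2)[OF Ks] by simp
  have Jq: "J q" and Jp: "J p"
    unfolding J_def using p q' one pc(1)
    by (intro conjI exI[of _ 1] exI[of _ 0]; simp)
       (intro conjI exI[of _ 0] exI[of _ 1]; use p one pc(1) in simp)
  obtain d where d: "J d" "d \<noteq> 0" "\<And>h. J h \<Longrightarrow> h \<noteq> 0 \<Longrightarrow> degree d \<le> degree h"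
    using ex_has_least_nat[of "\<lambda>h. J h \<and> h \<noteq> 0" q degree] Jq q'(2) by blast
  then obtain u v where uv: "poly_over K d" "poly_over K u" "poly_over K v" "d = u * q + v * p"
    by (auto simp: J_def)
  have dvd: "\<exists>s. poly_over K s \<and> h = d * s" if Jh: "J h" for h
  proof -
    have h: "poly_over K h" using Jh by (auto simp: J_def)
    obtain u' v' where h': "poly_over K u'" "poly_over K v'" "h = u' * q + v' * p"
      using Jh unfolding J_def by blast
    obtain s r where sr: "poly_over K s" "poly_over K r" "h = d * s + r" "r = 0 \<or> degree r < degree d"
      using poly_over_divmod[OF K uv(1) d(2) h] by blast
    have "r = (u' - s * u) * q + (v' - s * v) * p"
      using sr(3) uv(4) h'(3) by (simp add: algebra_simps)
    then have "J r"
      unfolding J_def using sr(2) pc(4)[OF h'(1) pc(5)[OF sr(1) uv(2)]]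
        pc(4)[OF h'(2) pc(5)[OF sr(1) uv(3)]] by blast
    then have "r = 0" using d(3)[of r] sr(4) by force
    then show ?thesis using sr by auto
  qed
  obtain q1 p1 where q1: "poly_over K q1" "q = d * q1" and p1: "poly_over K p1" "p = d * p1"
    using dvd[OF Jq] dvd[OF Jp] by auto
  have "q1 \<noteq> 0" using q1 q' by auto
  moreover have "poly q1 z * b = poly p1 z"
    using p(2) nz[OF uv(1) d(2)] by (simp add: q1 p1)
  ultimately have "D q1" using q1 p1 by (auto simp: D_def)
  then have "degree q \<le> degree q1" by (rule q)
  \<comment> \<open>A nonconstant \<open>d\<close> could be cancelled to give a denominator of
    smaller degree.\<close>
  then have "degree d = 0" using q1(2) d(2) \<open>q1 \<noteq> 0\<close> by (simp add: degree_mult_eq)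
  then obtain c where c: "d = [:c:]" by (auto elim: degree_eq_zeroE)
  then have "c \<noteq> 0" "c \<in> K" using d(2) uv(1) by (auto simp: poly_over_def dest: spec[of _ 0])
  have qz: "poly q z \<noteq> 0" using nz q' by auto
  have "c = poly u z * poly q z + poly v z * poly p z"
    using arg_cong[OF uv(4), of "\<lambda>h. poly h z"] by (simp add: c)
  also have "\<dots> = poly q z * (poly u z + poly v z * b)"
    by (simp flip: p(2) add: algebra_simps)
  finally have inv: "inverse (poly q z) = inverse c * (poly u z + poly v z * b)"
    using qz \<open>c \<noteq> 0\<close> by (simp add: field_simps)
  have "inverse (poly q z) \<in> adjoin K z"
  proof (rule ccontr)
    assume "inverse (poly q z) \<notin> adjoin K z"
    then obtain V where V: "val_ring V" "adjoin K z \<subseteq> V" "inverse (poly q z) \<notin> V"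
      using exists_val_ring[OF adjoin(1)[OF Ks] inA[OF q'(1)] qz] by blast
    have "b \<in> V" "inverse c \<in> V" "poly u z \<in> V" "poly v z \<in> V"
      using V b inA uv adjoin(2)[OF Ks, of z] is_subfieldD(2)[OF K \<open>c \<in> K\<close>] by auto
    then show False
      using V(1,3) is_subringD(3,5)[of V] unfolding inv val_ring_def by blast
  qed
  moreover have "b = poly p z * inverse (poly q z)"
    using p(2) qz by (simp add: field_simps)
  ultimately show "b \<in> adjoin K z" using inA[OF p(1)] Ac(5) by auto
qed

text \<open>Translation by \<open>1\<close> permutes \<open>K\<close>, so comparing the sums over
  \<open>K\<close> gives \<open>of_nat (card K) = 0\<close>.\<close>

lemma card_power2_subfield_char:
  fixes K :: "'f::field set"
  assumes K: "is_subfield K" and "finite K" "card K = 2 ^ e"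
  shows "1 + 1 = (0::'f)"
proof -
  note c = is_subringD[OF is_subfieldD(1)[OF K]]
  have "bij_betw (\<lambda>a. a + 1) K K"
    by (rule bij_betw_byWitness[where f' = "\<lambda>a. a - 1"]) (auto intro: c)
  then have "(\<Sum>a\<in>K. a + 1) = \<Sum>K" by (rule sum.reindex_bij_betw)
  then have "of_nat (card K) = (0::'f)" by (simp add: sum.distrib)
  then have "(1 + 1) ^ e = (0::'f)" using assms(3) by simp
  then show ?thesis by (simp only: power_eq_0_iff)
qed

section \<open>Orders with respect to a common uniformizer\<close>

lemma val_ringD:
  assumes "val_ring V"
  shows "is_subring V" "a \<notin> V \<Longrightarrow> inverse a \<in> V" "inverse a \<notin> V \<Longrightarrow> a \<in> V"
  using assms by (auto simp: val_ring_def)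

lemma unit_at_mult:
  assumes "is_subring P" "unit_at P a" "unit_at P b"
  shows "unit_at P (a * b)"
  using assms is_subringD(5)[OF assms(1)] by (auto simp: unit_at_def)

lemma unit_at_inverse: "unit_at P a \<Longrightarrow> unit_at P (inverse a)"
  by (auto simp: unit_at_def)

lemma unit_at_1: "is_subring P \<Longrightarrow> unit_at P 1"
  using is_subringD(2) by (auto simp: unit_at_def)

lemma unit_at_power:
  assumes "is_subring P" "unit_at P a"
  shows "unit_at P (a ^ i)"
  using assms by (induction i) (auto intro: unit_at_mult unit_at_1)

lemma val_ring_root:
  assumes V: "val_ring V" and "a ^ i \<in> V" "i > 0"
  shows "a \<in> V"
proof (rule ccontr)
  note c = is_subringD[OF val_ringD(1)[OF V]]
  assume a: "a \<notin> V"
  then have "inverse a \<in> V" "a \<noteq> 0" using val_ringD(2)[OF V a] c(1) by auto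
  obtain j where j: "i = Suc j" using \<open>i > 0\<close> by (cases i) auto
  have "a = a ^ i * inverse a ^ j" using \<open>a \<noteq> 0\<close> by (simp add: j field_simps)
  then show False using a \<open>inverse a \<in> V\<close> assms(2) c(5,7) by metis
qed

lemma unit_at_root:
  assumes V: "val_ring V" and "unit_at V (a ^ i)" "i > 0"
  shows "unit_at V a"
proof -
  have "a ^ i \<in> V" "inverse a ^ i \<in> V" "a \<noteq> 0"
    using assms(2,3) by (auto simp: unit_at_def power_inverse)
  then show ?thesis using val_ring_root[OF V _ \<open>i > 0\<close>] unfolding unit_at_def by blast
qed

text \<open>\<open>inverse a\<close> outside \<open>V\<close> means that \<open>a\<close> is a
  nonzero element of the maximal ideal. Of \<open>(1 + a) / a = 1 / a + 1\<close> and its inverse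
  \<open>1 - 1 / (1 + a)\<close>, only the second can lie in \<open>V\<close>.\<close>

lemma unit_at_one_plus:
  assumes V: "val_ring V" and a: "inverse a \<notin> V"
  shows "unit_at V (1 + a)"
proof -
  note c = is_subringD[OF val_ringD(1)[OF V]]
  have aV: "a \<in> V" using val_ringD(3)[OF V a] .
  have nz: "1 + a \<noteq> 0"
  proof
    assume "1 + a = 0"
    then have "a = - 1" by (simp add: add_eq_0_iff)
    then show False using a c(2) c(6)[of 1] by simp
  qed
  have "inverse (1 + a) \<in> V"
  proof (rule ccontr)
    assume n: "inverse (1 + a) \<notin> V"
    show False
    proof (cases "a = 0")
      case True
      then show ?thesis using n c(2) by simp
    next
      case False
      have "(1 + a) * inverse a \<in> V \<or> inverse ((1 + a) * inverse a) \<in> V"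
        using V by (auto simp: val_ring_def)
      moreover have "(1 + a) * inverse a = inverse a + 1" using False by (simp add: field_simps)
      moreover have "inverse ((1 + a) * inverse a) = 1 - inverse (1 + a)"
        using False nz by (simp add: field_simps)
      ultimately have "inverse a + 1 \<in> V \<or> 1 - inverse (1 + a) \<in> V" by metis
      moreover have "inverse a = inverse a + 1 - 1" "inverse (1 + a) = 1 - (1 - inverse (1 + a))"
        by simp_all
      ultimately show False using a n c(2,4) by metis
    qed
  qed
  then show ?thesis using nz aV c(2,3) by (simp add: unit_at_def)
qed

text \<open>All places at infinity are treated together until their uniqueness is known. At first
  \<open>t\<close> is only a common element of their maximal ideals; \<open>local_param_t\<close>
  makes it a uniformizer.\<close>

locale uniformized =
  fixes I :: "'f::field set set" and t :: 'f
  assumes I: "I \<noteq> {}" and val_ring_I: "P \<in> I \<Longrightarrow> val_ring P"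
    and t: "P \<in> I \<Longrightarrow> inverse t \<notin> P"
begin

text \<open>A relation, with one order for all places of \<open>I\<close>; it avoids
  \<open>place_val\<close>, which makes sense only once a local parameter is known.\<close>

definition ord_at :: "'f \<Rightarrow> int \<Rightarrow> bool" where
  "ord_at f k \<longleftrightarrow> (\<forall>P\<in>I. unit_at P (f * t powi (- k)))"

lemma Pc: "P \<in> I \<Longrightarrow> is_subring P"
  using val_ring_I val_ringD(1) by blast

lemma t_nonzero: "t \<noteq> 0"
  using I t is_subringD(1)[OF Pc] by fastforce

lemma ord_nonzero: "ord_at f k \<Longrightarrow> f \<noteq> 0"
  using I by (auto simp: ord_at_def unit_at_def)

lemma ord_mult:
  assumes "ord_at f a" "ord_at g b"
  shows "ord_at (f * g) (a + b)"
proof -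
  have "f * g * t powi (- (a + b)) = (f * t powi (- a)) * (g * t powi (- b))"
    using t_nonzero by (simp add: power_int_add power_int_diff power_int_minus field_simps)
  then show ?thesis using assms unit_at_mult[OF Pc] unfolding ord_at_def by metis
qed

lemma ord_inverse:
  assumes "ord_at f a"
  shows "ord_at (inverse f) (- a)"
proof -
  have "inverse f * t powi (- (- a)) = inverse (f * t powi (- a))"
    using t_nonzero by (simp add: power_int_minus field_simps)
  then show ?thesis using assms unit_at_inverse unfolding ord_at_def by metis
qed

lemma ord_divide:
  assumes "ord_at f a" "ord_at g b"
  shows "ord_at (f / g) (a - b)"
  using ord_mult[OF assms(1) ord_inverse[OF assms(2)]] by (simp add: divide_inverse)

lemma ord_unit: "(\<And>P. P \<in> I \<Longrightarrow> unit_at P f) \<Longrightarrow> ord_at f 0"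
  by (auto simp: ord_at_def)

lemma ord_1: "ord_at 1 0"
  using unit_at_1[OF Pc] by (intro ord_unit)

lemma ord_t: "ord_at t 1"
  unfolding ord_at_def using unit_at_1[OF Pc] t_nonzero by (simp add: power_int_minus)

lemma ord_power: "ord_at f a \<Longrightarrow> ord_at (f ^ i) (int i * a)"
proof (induction i)
  case (Suc i)
  then show ?case using ord_mult[of f a "f ^ i" "int i * a"] by (simp add: algebra_simps)
qed (simp add: ord_1)

lemma ord_root:
  assumes "ord_at (f ^ i) (int i * a)" "i > 0"
  shows "ord_at f a"
  unfolding ord_at_def
proof
  fix P assume P: "P \<in> I"
  have "f ^ i * t powi (- (int i * a)) = (f * t powi (- a)) ^ i"
    by (simp add: power_mult_distrib power_int_power' mult.commute flip: power_int_minus)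
  then show "unit_at P (f * t powi (- a))"
    using assms P unit_at_root[OF val_ring_I[OF P]] unfolding ord_at_def by metis
qed

lemma powi_nonneg_in:
  assumes "P \<in> I" "k \<ge> 0"
  shows "t powi k \<in> P"
  using assms is_subringD(7)[OF Pc] val_ringD(3)[OF val_ring_I] t by (simp add: power_int_def)

lemma powi_neg_notin:
  assumes P: "P \<in> I" and "k < 0"
  shows "t powi k \<notin> P"
proof
  assume "t powi k \<in> P"
  moreover have "t powi (- k - 1) \<in> P" using assms by (intro powi_nonneg_in) auto
  ultimately have "t powi k * t powi (- k - 1) \<in> P" using is_subringD(5)[OF Pc[OF P]] by blast
  moreover have "t powi k * t powi (- k - 1) = inverse t"
    using t_nonzero by (simp flip: power_int_add)
  ultimately show False using t P by auto
qed

lemma ord_in_iff: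
  assumes "ord_at f k" and P: "P \<in> I"
  shows "f \<in> P \<longleftrightarrow> k \<ge> 0"
proof -
  define u where "u = f * t powi (- k)"
  have u: "unit_at P u" using assms by (auto simp: ord_at_def u_def)
  have f: "f = u * t powi k" "t powi k = f * inverse u"
    using t_nonzero u by (simp_all add: u_def power_int_minus unit_at_def field_simps)
  have "f \<in> P \<longleftrightarrow> t powi k \<in> P"
    using f u is_subringD(5)[OF Pc[OF P]] unfolding unit_at_def by metis
  then show ?thesis using powi_nonneg_in[OF P, of k] powi_neg_notin[OF P, of k] by linarith
qed

lemma ord_unique:
  assumes "ord_at f a" "ord_at f b"
  shows "a = b"
proof -
  obtain P where P: "P \<in> I" using I by auto
  have "ord_at 1 (a - b)" "ord_at 1 (b - a)"
    using ord_divide[OF assms] ord_divide[OF assms(2,1)] ord_nonzero[OF assms(1)] by auto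
  then have "0 \<le> a - b" "0 \<le> b - a"
    using ord_in_iff[OF _ P] is_subringD(2)[OF Pc[OF P]] by blast+
  then show ?thesis by simp
qed

text \<open>\<open>f + g = f * (1 + g / f)\<close>, where \<open>g / f\<close> has positive order,
  so the second factor is a unit.\<close>

lemma ord_add:
  assumes f: "ord_at f a" and g: "ord_at g b" and "a < b"
  shows "ord_at (f + g) a"
proof -
  have d: "ord_at (g / f) (b - a)" using f g by (intro ord_divide)
  have "ord_at (1 + g / f) 0"
  proof (intro ord_unit unit_at_one_plus val_ring_I)
    fix P assume P: "P \<in> I"
    show "inverse (g / f) \<notin> P"
      using ord_in_iff[OF ord_inverse[OF d] P] \<open>a < b\<close> by simp
  qed
  then have "ord_at (f * (1 + g / f)) (a + 0)" by (intro ord_mult f)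
  moreover have "f * (1 + g / f) = f + g" using ord_nonzero[OF f] by (simp add: distrib_left)
  ultimately show ?thesis by simp
qed

definition ord_set :: "'f set \<Rightarrow> int set \<Rightarrow> bool" where
  "ord_set A G \<longleftrightarrow> (\<forall>f\<in>A. f \<noteq> 0 \<longrightarrow> (\<exists>k\<in>G. ord_at f k))"

text \<open>Divisibility by \<open>d\<close> tells the orders of \<open>a\<close> and
  \<open>b * s\<close> apart, so their leading terms cannot cancel.\<close>

lemma ord_set_qext:
  assumes A: "ord_set A G" and s: "ord_at s e"
    and G: "\<And>g. g \<in> G \<Longrightarrow> d dvd g" and e: "\<not> d dvd e"
    and G': "\<And>g. g \<in> G \<Longrightarrow> g \<in> G'" "\<And>g. g \<in> G \<Longrightarrow> g + e \<in> G'"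
  shows "ord_set (qext A s) G'"
  unfolding ord_set_def
proof (intro ballI impI)
  fix f assume "f \<in> qext A s" "f \<noteq> 0"
  then obtain a b where f: "f = a + b * s" "a \<in> A" "b \<in> A" by (auto simp: qext_def)
  have a: "\<exists>k\<in>G. ord_at a k" if "a \<noteq> 0" using A f(2) that by (auto simp: ord_set_def)
  have b: "\<exists>k\<in>G. ord_at (b * s) (k + e)" if "b \<noteq> 0"
    using A f(3) that ord_mult[OF _ s] by (fastforce simp: ord_set_def)
  consider "a = 0" "b \<noteq> 0" | "a \<noteq> 0" "b = 0" | "a \<noteq> 0" "b \<noteq> 0"
    using \<open>f \<noteq> 0\<close> f(1) by fastforce
  then show "\<exists>k\<in>G'. ord_at f k"
  proof cases
    case 1
    then show ?thesis using b G' f(1) by auto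
  next
    case 2
    then show ?thesis using a G' f(1) by auto
  next
    case 3
    then obtain k l where kl: "k \<in> G" "ord_at a k" "l \<in> G" "ord_at (b * s) (l + e)" using a b by auto
    then have "k \<noteq> l + e" using G e by (metis dvd_add_right_iff)
    then consider "k < l + e" | "l + e < k" by linarith
    then show ?thesis
    proof cases
      case 1
      then have "ord_at f k" using ord_add kl f(1) by auto
      then show ?thesis using kl G' by auto
    next
      case 2
      then have "ord_at f (l + e)" using ord_add[OF kl(4,2)] f(1) by (simp add: add.commute)
      then show ?thesis using kl G' by auto
    qed
  qed
qed

lemma ord_notin:
  assumes "ord_set A G" "ord_at s e" "\<And>g. g \<in> G \<Longrightarrow> d dvd g" "\<not> d dvd e"
  shows "s \<notin> A"
proof
  assume "s \<in> A"
  then obtain k where "k \<in> G" "ord_at s k" using assms(1) ord_nonzero[OF assms(2)]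
    by (auto simp: ord_set_def)
  then show False using ord_unique[OF assms(2)] assms(3,4) by blast
qed

text \<open>Horner's scheme: nonzero constants are units at every place, so the multiple of
  \<open>z\<close> dominates at each step.\<close>

lemma ord_poly:
  assumes K: "is_subfield K" "\<And>P. P \<in> I \<Longrightarrow> K \<subseteq> P" and z: "ord_at z e" "e < 0"
    and "poly_over K p" "p \<noteq> 0"
  shows "ord_at (poly p z) (int (degree p) * e)"
  using assms(5,6)
proof (induction p)
  case (pCons a p)
  have a: "a \<in> K" using pCons.prems by (auto simp: poly_over_def dest: spec[of _ 0])
  have a0: "ord_at a 0" if "a \<noteq> 0"
    using a that K is_subfieldD(2)[OF K(1) a] by (intro ord_unit) (auto simp: unit_at_def)
  show ?case
  proof (cases "p = 0")
    case True
    then show ?thesis using a0 pCons.prems by simp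
  next
    case False
    have "poly_over K p"
      unfolding poly_over_def using pCons.prems(1) by (metis coeff_pCons_Suc poly_over_def)
    then have p: "ord_at (z * poly p z) (e + int (degree p) * e)"
      using pCons.IH False by (intro ord_mult z) auto
    have e: "e + int (degree p) * e = int (degree (pCons a p)) * e"
      using False by (simp add: algebra_simps)
    have "e + int (degree p) * e < 0"
      using z(2) by (simp add: add_neg_nonpos mult_nonneg_nonpos)
    then have "ord_at (z * poly p z + a) (e + int (degree p) * e)" if "a \<noteq> 0"
      using ord_add[OF p a0] that by auto
    then show ?thesis using p by (cases "a = 0") (auto simp: e add.commute)
  qed
qed auto

text \<open>Once every nonzero element has an order, a nonzero nonunit of \<open>P\<close> has order
  at least \<open>1\<close> and is divisible by \<open>t\<close>.\<close>

lemma local_param_t: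
  assumes "ord_set UNIV UNIV" and P: "P \<in> I"
  shows "local_param P t"
  unfolding local_param_def
proof (intro equalityI subsetI)
  fix a assume "a \<in> {a \<in> P. \<not> unit_at P a}"
  then have a: "a \<in> P" "\<not> unit_at P a" by auto
  show "a \<in> {t * a | a. a \<in> P}"
  proof (cases "a = 0")
    case True
    then show ?thesis using is_subringD(1)[OF Pc[OF P]] by force
  next
    case False
    then obtain k where k: "ord_at a k" using assms by (auto simp: ord_set_def)
    have "k \<noteq> 0" using k a P by (auto simp: ord_at_def)
    then have "k - 1 \<ge> 0" using ord_in_iff[OF k P] a by linarith
    then have "a / t \<in> P" using ord_in_iff[OF ord_divide[OF k ord_t] P] by simp
    moreover have "a = t * (a / t)" using t_nonzero by simp
    ultimately show ?thesis by blast
  qed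
next
  fix a assume "a \<in> {t * a | a. a \<in> P}"
  then obtain b where b: "a = t * b" "b \<in> P" by auto
  have "t \<in> P" using val_ringD(3)[OF val_ring_I[OF P]] t[OF P] .
  then have "a \<in> P" using b is_subringD(5)[OF Pc[OF P]] by auto
  moreover have "\<not> unit_at P a"
  proof
    assume "unit_at P a"
    then have "inverse a * b \<in> P" "a \<noteq> 0" using b is_subringD(5)[OF Pc[OF P]]
      by (auto simp: unit_at_def)
    moreover have "inverse a * b = inverse t" using b \<open>a \<noteq> 0\<close> by (simp add: field_simps)
    ultimately show False using t P by auto
  qed
  ultimately show "a \<in> {a \<in> P. \<not> unit_at P a}" by auto
qed

lemma place_val_eq:
  assumes "ord_set UNIV UNIV" and P: "I = {P}" and f: "ord_at f k"
  shows "place_val P f = k"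
  unfolding place_val_def
proof (rule the_equality)
  have t: "local_param P t" using local_param_t[OF assms(1)] P by simp
  have "f = t powi k * (f * t powi (- k))"
    using t_nonzero by (simp add: power_int_minus field_simps)
  then show "\<exists>t u. local_param P t \<and> unit_at P u \<and> f = t powi k * u"
    using t f P unfolding ord_at_def by blast
  fix l assume "\<exists>t u. local_param P t \<and> unit_at P u \<and> f = t powi l * u"
  then obtain s u where s: "local_param P s" "unit_at P u" "f = s powi l * u" by auto
  have "P \<in> I" using P by simp
  have one: "1 \<in> P" using is_subringD(2)[OF Pc[OF \<open>P \<in> I\<close>]] .
  \<comment> \<open>Two local parameters generate the same ideal, so \<open>s\<close> is
    \<open>t\<close> times a unit and has order \<open>1\<close>; the exponent therefore does not
    depend on the parameter.\<close>
  have "{t * a | a. a \<in> P} = {s * a | a. a \<in> P}"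
    using t s(1) by (simp add: local_param_def)
  moreover have "t \<in> {t * a | a. a \<in> P}" "s \<in> {s * a | a. a \<in> P}" using one by force+
  ultimately have "t \<in> {s * a | a. a \<in> P}" "s \<in> {t * a | a. a \<in> P}" by simp_all
  then obtain a b where ab: "t = s * a" "a \<in> P" "s = t * b" "b \<in> P" by blast
  have "b \<noteq> 0" using ab t_nonzero by auto
  have "t = t * (b * a)" using ab by (metis mult.assoc)
  then have "b * a = 1" using t_nonzero by (metis mult_cancel_left mult.right_neutral)
  then have "inverse b = a" by (rule inverse_unique)
  then have "unit_at P b" using ab \<open>b \<noteq> 0\<close> by (auto simp: unit_at_def)
  then have "ord_at s (1 + 0)" unfolding ab(3) using P by (intro ord_mult ord_t ord_unit) auto
  then have s1: "ord_at s 1" by simp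
  have "ord_at (s powi l) l"
  proof (cases "l \<ge> 0")
    case True
    then show ?thesis using ord_power[OF s1, of "nat l"] by (simp add: power_int_def)
  next
    case False
    then show ?thesis using ord_inverse[OF ord_power[OF s1, of "nat (- l)"]]
      by (simp add: power_int_def power_inverse)
  qed
  then have "ord_at f (l + 0)" unfolding s(3) using s(2) P by (intro ord_mult ord_unit) auto
  then show "l = k" using ord_unique[OF f] by simp
qed

end

section \<open>The Weierstrass semigroup at infinity\<close>

text \<open>The values of \<open>3 i + 2 j\<close>: the even ones have \<open>i = 0\<close>, the odd
  ones \<open>i = 1\<close>. The class of \<open>1\<close> modulo \<open>8\<close> is represented by
  \<open>9\<close>.\<close>

definition multipliers :: "nat set" where
  "multipliers = {0, 2, 3, 4, 5, 6, 7, 9}"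

definition ggs_semigroup :: "nat \<Rightarrow> nat set" where
  "ggs_semigroup m = {u * m + 8 * k | u k. u \<in> multipliers}"

definition pole_orders :: "nat \<Rightarrow> nat set \<Rightarrow> int set" where
  "pole_orders m U = {- int (u * m + 8 * k) | u k. u \<in> U}"

lemma pole_orders_shift:
  assumes "g \<in> pole_orders m U" "\<And>u. u \<in> U \<Longrightarrow> u + v \<in> U'"
  shows "g - int (v * m) \<in> pole_orders m U'"
proof -
  obtain u k where "g = - int (u * m + 8 * k)" "u \<in> U" using assms(1) by (auto simp: pole_orders_def)
  then have "g - int (v * m) = - int ((u + v) * m + 8 * k)" "u + v \<in> U'"
    using assms(2) by (auto simp: algebra_simps)
  then show ?thesis unfolding pole_orders_def by blast
qed

lemma pole_orders_dvd:
  assumes "g \<in> pole_orders m U" "\<And>u. u \<in> U \<Longrightarrow> d dvd u" "d dvd 8"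
  shows "int d dvd g"
  using assms by (auto simp: pole_orders_def simp del: of_nat_add of_nat_mult intro!: dvd_add dvd_mult2)

locale ggs_curve =
  fixes n m :: nat and K :: "'f::field set" and x y z :: 'f
  assumes ggs: "GGS_function_field n K x y z" and m: "3 * m = 2 ^ n + 1" and n: "n \<ge> 3"
begin

definition w where "w = y\<^sup>2 + y"

definition infinity :: "'f set set" where
  "infinity = {P. is_place_at_infinity K x y z P}"

text \<open>As \<open>3 m = 2 ^ n + 1\<close>, the exponent equals \<open>(3 m - 1) / 8\<close>,
  which makes \<open>z * t ^ 8 = z ^ (3 * m) / x ^ 8\<close>.\<close>

definition t where "t = z ^ (2 ^ (n - 3)) / x"

lemma K: "is_subfield K" and z: "transcendental_over K z"
  and gen: "is_subfield hull (K \<union> {x, y, z}) = UNIV"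
  and xy: "x\<^sup>2 + x = y ^ 3" and yz: "y ^ 4 - y = z ^ m"
proof -
  have "(2 ^ n + 1) div 3 = m" using m by linarith
  then show "is_subfield K" "transcendental_over K z"
    "is_subfield hull (K \<union> {x, y, z}) = UNIV" "x\<^sup>2 + x = y ^ 3" "y ^ 4 - y = z ^ m"
    using ggs unfolding GGS_function_field_def by auto
qed

lemma char2: "1 + 1 = (0::'f)"
  using ggs card_power2_subfield_char unfolding GGS_function_field_def by blast

lemma m_odd: "odd m"
proof -
  have "even (2 ^ n :: nat)" using n by simp
  then have "odd (3 * m)" using m by simp
  then show ?thesis by simp
qed

lemma m_pos: "m > 0"
  using m_odd odd_pos by blast

lemma wz: "w\<^sup>2 + w = z ^ m"
proof -
  have "(1 + 1) * a = (0::'f)" for a using char2 by simp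
  then have two: "2 * a = (0::'f)" for a by (simp add: one_add_one)
  have "w\<^sup>2 + w = y ^ 4 - y + 2 * (y ^ 3 + y\<^sup>2 + y)"
    unfolding w_def by (simp add: power2_eq_square power3_eq_cube power4_eq_xxxx algebra_simps)
  then show ?thesis using yz two by simp
qed

lemma K_subring: "is_subring K"
  using is_subfieldD(1)[OF K] .

lemma z_notin_K: "z \<notin> K"
proof
  assume "z \<in> K"
  then have "poly_over K [:- z, 1:]"
    using is_subringD[OF K_subring]
    by (auto simp: poly_over_def coeff_pCons split: nat.splits)
  then show False using z unfolding transcendental_over_def poly_over_def
    by (metis add.inverse_inverse add.right_inverse mult.right_neutral one_neq_zero
        pCons_eq_0_iff poly_0 poly_pCons mult_zero_right add_0_right)
qed

section \<open>Poles and leading terms at infinity\<close>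

lemma place_val_ring: "is_place K P \<Longrightarrow> val_ring P" "is_place K P \<Longrightarrow> K \<subseteq> P"
  using K_subring is_subringD(1,2)[OF K_subring]
  by (auto simp: is_place_def val_ring_def is_subring_def)

text \<open>A pole of one coordinate forces poles of all three: regularity passes from
  \<open>z\<close> to \<open>y\<close> to \<open>x\<close> by integrality, and from \<open>x\<close>
  to \<open>y\<close> to \<open>z\<close> by taking roots.\<close>

lemma not_integral_at_infinity:
  assumes "P \<in> infinity"
  shows "z \<notin> P" "y \<notin> P" "x \<notin> P"
proof -
  have P: "val_ring P" "\<not> {x, y, z} \<subseteq> P"
    using assms place_val_ring by (auto simp: infinity_def is_place_at_infinity_def)
  note c = is_subringD[OF val_ringD(1)[OF P(1)]]
  have yP: "y \<in> P" if "z \<in> P"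
  proof (rule ccontr)
    assume "y \<notin> P"
    then have y: "inverse y \<in> P" "y \<noteq> 0" using val_ringD(2)[OF P(1)] c(1) by auto
    have "y = (y + z ^ m) * inverse y ^ 3"
      unfolding yz[symmetric] using y(2) by (simp add: field_simps power4_eq_xxxx power3_eq_cube)
    also have "\<dots> = inverse y ^ 2 + z ^ m * inverse y ^ 3"
      using y(2) by (simp add: field_simps power2_eq_square power3_eq_cube)
    also have "\<dots> \<in> P" by (intro c y that)
    finally show False using \<open>y \<notin> P\<close> by simp
  qed
  have xP: "x \<in> P" if "y \<in> P"
  proof (rule ccontr)
    assume "x \<notin> P"
    then have x: "inverse x \<in> P" "x \<noteq> 0" using val_ringD(2)[OF P(1)] c(1) by auto
    have "x = y ^ 3 * inverse x - 1"
      unfolding xy[symmetric] using x(2) by (simp add: field_simps power2_eq_square)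
    also have "\<dots> \<in> P" by (intro c x that)
    finally show False using \<open>x \<notin> P\<close> by simp
  qed
  show z: "z \<notin> P" using yP xP P(2) by auto
  show y: "y \<notin> P"
  proof
    assume "y \<in> P"
    then have "y ^ 4 - y \<in> P" by (intro c)
    then have "z ^ m \<in> P" by (simp add: yz)
    then show False using z val_ring_root[OF P(1) _ m_pos] by blast
  qed
  show "x \<notin> P"
  proof
    assume "x \<in> P"
    then have "x\<^sup>2 + x \<in> P" by (intro c)
    then have "y ^ 3 \<in> P" by (simp add: xy)
    then show False using y val_ring_root[OF P(1), of y 3] by simp
  qed
qed

text \<open>The quotients are \<open>1 + 1 / x\<close> and \<open>1 - 1 / y ^ 3\<close>, where
  \<open>1 / x\<close> and \<open>1 / y ^ 3\<close> lie in the maximal ideal.\<close>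

lemma leading_units:
  assumes P: "P \<in> infinity"
  shows "unit_at P (y ^ 3 / x\<^sup>2)" "unit_at P (z ^ m / y ^ 4)"
proof -
  have V: "val_ring P" using P place_val_ring by (auto simp: infinity_def is_place_at_infinity_def)
  note notin = not_integral_at_infinity[OF P] and c = is_subringD[OF val_ringD(1)[OF V]]
  have nz: "x \<noteq> 0" "y \<noteq> 0" using notin c(1) by auto
  have "y ^ 3 / x\<^sup>2 = 1 + inverse x"
    unfolding xy[symmetric] using nz by (simp add: field_simps power2_eq_square)
  moreover have "unit_at P (1 + inverse x)"
    using notin by (intro unit_at_one_plus[OF V]) simp
  ultimately show "unit_at P (y ^ 3 / x\<^sup>2)" by metis
  have "z ^ m / y ^ 4 = 1 + inverse (- (y ^ 3))"
    unfolding yz[symmetric] using nz by (simp add: field_simps power4_eq_xxxx power3_eq_cube)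
  moreover have "unit_at P (1 + inverse (- (y ^ 3)))"
  proof (intro unit_at_one_plus[OF V] notI)
    assume "inverse (inverse (- (y ^ 3))) \<in> P"
    then have "y ^ 3 \<in> P" using c(6)[of "- (y ^ 3)"] by simp
    then show False using notin val_ring_root[OF V, of y 3] by simp
  qed
  ultimately show "unit_at P (z ^ m / y ^ 4)" by metis
qed

lemma t_power_unit:
  assumes P: "P \<in> infinity"
  shows "unit_at P (z * t ^ 8)"
proof -
  have V: "val_ring P" using P place_val_ring by (auto simp: infinity_def is_place_at_infinity_def)
  note notin = not_integral_at_infinity[OF P] and sub = val_ringD(1)[OF V]
  have nz: "x \<noteq> 0" "y \<noteq> 0" using notin is_subringD(1)[OF sub] by auto
  have "(2::nat) ^ (n - 3) * 8 = 2 ^ n"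
    using n power_add[of "2::nat" "n - 3" 3] by simp
  then have "z * (z ^ (2 ^ (n - 3))) ^ 8 = z ^ (m * 3)"
    using m by (simp flip: power_mult power_Suc add: mult.commute)
  then have "z * t ^ 8 = (z ^ m) ^ 3 / x ^ 8"
    by (simp add: t_def power_divide power_mult)
  \<comment> \<open>The exponents \<open>3\<close> and \<open>4\<close> are the ones for which the
    powers \<open>y ^ 12\<close> cancel.\<close>
  also have "\<dots> = (z ^ m / y ^ 4) ^ 3 * (y ^ 3 / x\<^sup>2) ^ 4"
    using nz by (simp add: power_divide power_mult_distrib flip: power_mult)
  finally show ?thesis
    using leading_units[OF P] by (simp only:) (intro unit_at_mult[OF sub] unit_at_power[OF sub])
qed

lemma uniformized_infinity:
  assumes "infinity \<noteq> {}"
  shows "uniformized infinity t"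
proof
  show "infinity \<noteq> {}" by fact
  fix P assume P: "P \<in> infinity"
  then show V: "val_ring P" using place_val_ring by (auto simp: infinity_def is_place_at_infinity_def)
  note c = is_subringD[OF val_ringD(1)[OF V]]
  show "inverse t \<notin> P"
  proof
    assume "inverse t \<in> P"
    moreover have "z * t ^ 8 \<in> P" using t_power_unit[OF P] by (simp add: unit_at_def)
    ultimately have "(z * t ^ 8) * inverse t ^ 8 \<in> P" using c(5,7) by blast
    moreover have "t \<noteq> 0" using t_power_unit[OF P] by (auto simp: unit_at_def)
    ultimately have "z \<in> P" by (simp add: field_simps)
    then show False using not_integral_at_infinity[OF P] by simp
  qed
qed

section \<open>The tower of quadratic extensions and its orders at infinity\<close>

definition R1 where "R1 = qext (adjoin K z) w"
definition R2 where "R2 = qext R1 y"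
text \<open>The coordinate ring \<open>K[x, y, z]\<close>, spanned over \<open>K[z]\<close> by the
  eight squarefree products of \<open>w\<close>, \<open>y\<close>, \<open>x\<close>.\<close>

definition R3 where "R3 = qext R2 x"
definition L1 where "L1 = qext (ratfun K z) w"
definition L2 where "L2 = qext L1 y"
definition L3 where "L3 = qext L2 x"

text \<open>A place at infinity already enters the algebra of the tower: that \<open>w\<close>,
  \<open>y\<close>, \<open>x\<close> generate proper extensions is read off from their orders
  there.\<close>

context
  assumes nonempty: "infinity \<noteq> {}"
begin

interpretation uniformized infinity t
  by (rule uniformized_infinity[OF nonempty])

lemma ord_z: "ord_at z (- 8)"
  using t_power_unit t_nonzero unfolding ord_at_def by simp

lemma ord_y: "ord_at y (- int (2 * m))"
proof (rule ord_root)
  have "ord_at (z ^ m / y ^ 4) 0" using leading_units by (intro ord_unit)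
  from ord_divide[OF ord_power[OF ord_z, of m] this]
  have "ord_at (z ^ m / (z ^ m / y ^ 4)) (int m * - 8 - 0)" .
  moreover have "z \<noteq> 0" using ord_nonzero[OF ord_z] .
  ultimately show "ord_at (y ^ 4) (int 4 * - int (2 * m))" by (simp add: algebra_simps)
qed simp

lemma ord_x: "ord_at x (- int (3 * m))"
proof (rule ord_root)
  have "ord_at (y ^ 3 / x\<^sup>2) 0" using leading_units by (intro ord_unit)
  from ord_divide[OF ord_power[OF ord_y, of 3] this]
  have "ord_at (y ^ 3 / (y ^ 3 / x\<^sup>2)) (int 3 * - int (2 * m) - 0)" .
  moreover have "y \<noteq> 0" using ord_nonzero[OF ord_y] .
  ultimately show "ord_at (x\<^sup>2) (int 2 * - int (3 * m))" by (simp add: algebra_simps)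
qed simp

lemma ord_w: "ord_at w (- int (4 * m))"
proof -
  have "ord_at (y\<^sup>2) (- int (4 * m))" using ord_power[OF ord_y, of 2] by simp
  then show ?thesis unfolding w_def using m_pos by (intro ord_add[OF _ ord_y]) auto
qed

lemma ord_poly_z:
  assumes "poly_over K p" "p \<noteq> 0"
  shows "ord_at (poly p z) (int (degree p) * - 8)"
  using assms place_val_ring by (intro ord_poly[OF K _ ord_z])
    (auto simp: infinity_def is_place_at_infinity_def)

lemma ord_set_adjoin: "ord_set (adjoin K z) (pole_orders m {0})"
  unfolding ord_set_def
proof (intro ballI impI)
  fix f assume "f \<in> adjoin K z" "f \<noteq> 0"
  then obtain p where "f = poly p z" "poly_over K p" by (auto simp: adjoin_def)
  moreover from this have "p \<noteq> 0" using \<open>f \<noteq> 0\<close> by auto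
  ultimately have "ord_at f (- int (0 * m + 8 * degree p))"
    using ord_poly_z by (simp add: mult.commute)
  then show "\<exists>k\<in>pole_orders m {0}. ord_at f k" unfolding pole_orders_def by blast
qed

lemma ord_set_ratfun: "ord_set (ratfun K z) {k. 8 dvd k}"
  unfolding ord_set_def
proof (intro ballI impI)
  fix f assume "f \<in> ratfun K z" "f \<noteq> 0"
  then obtain a b where f: "f = a / b" "a \<in> adjoin K z" "b \<in> adjoin K z" "b \<noteq> 0" "a \<noteq> 0"
    by (auto simp: ratfun_def)
  obtain k l where "k \<in> pole_orders m {0}" "ord_at a k" "l \<in> pole_orders m {0}" "ord_at b l"
    using ord_set_adjoin f unfolding ord_set_def by blast
  then show "\<exists>k\<in>{k. 8 dvd k}. ord_at f k"
    unfolding f(1) using pole_orders_dvd[of _ m "{0}" 8]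
    by (intro bexI[of _ "k - l"]) (auto intro: ord_divide)
qed

lemma not_dvd: "\<not> 8 dvd - int (4 * m)" "\<not> 4 dvd - int (2 * m)" "\<not> 2 dvd - int (3 * m)"
  using m_odd by presburger+

lemma ord_set_qext_pole_orders:
  assumes "ord_set A (pole_orders m U)" "ord_at s (- int (v * m))"
    and "\<And>u. u \<in> U \<Longrightarrow> d dvd u" "d dvd 8" "\<not> int d dvd - int (v * m)"
    and "U \<subseteq> U'" and shift: "\<And>u. u \<in> U \<Longrightarrow> u + v \<in> U'"
  shows "ord_set (qext A s) (pole_orders m U')"
proof (rule ord_set_qext[OF assms(1,2) _ assms(5)])
  fix g assume g: "g \<in> pole_orders m U"
  show "int d dvd g" using pole_orders_dvd[OF g assms(3,4)] .
  show "g \<in> pole_orders m U'" using g \<open>U \<subseteq> U'\<close> unfolding pole_orders_def by blast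
  show "g + - int (v * m) \<in> pole_orders m U'"
    using pole_orders_shift[OF g shift] by simp
qed

text \<open>For the fields a congruence on the orders suffices to show that the next generator is
  new. For the rings the actual pole orders are kept, since they give the semigroup.\<close>

lemma ord_sets:
  "ord_set L1 {k. 4 dvd k}" "ord_set L2 {k. 2 dvd k}" "ord_set L3 UNIV"
  "ord_set R1 (pole_orders m {0, 4})" "ord_set R2 (pole_orders m {0, 2, 4, 6})"
  "ord_set R3 (pole_orders m {0, 2, 3, 4, 5, 6, 7, 9})"
proof -
  show L1: "ord_set L1 {k. 4 dvd k}"
    unfolding L1_def
    by (rule ord_set_qext[OF ord_set_ratfun ord_w _ not_dvd(1)]; simp; presburger)
  show L2: "ord_set L2 {k. 2 dvd k}"
    unfolding L2_def
    by (rule ord_set_qext[OF L1 ord_y _ not_dvd(2)]; simp; presburger)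
  show "ord_set L3 UNIV"
    unfolding L3_def
    by (rule ord_set_qext[OF L2 ord_x _ not_dvd(3)]) simp_all
  show R1: "ord_set R1 (pole_orders m {0, 4})"
    unfolding R1_def by (rule ord_set_qext_pole_orders[OF ord_set_adjoin ord_w, where d = 8])
      (use not_dvd in auto)
  show R2: "ord_set R2 (pole_orders m {0, 2, 4, 6})"
    unfolding R2_def by (rule ord_set_qext_pole_orders[OF R1 ord_y, where d = 4])
      (use not_dvd in auto)
  show "ord_set R3 (pole_orders m {0, 2, 3, 4, 5, 6, 7, 9})"
    unfolding R3_def by (rule ord_set_qext_pole_orders[OF R2 ord_x, where d = 2])
      (use not_dvd in auto)
qed

lemma tower:
  "artin_schreier (ratfun K z) w" "artin_schreier L1 y" "artin_schreier L2 x"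
  "L3 = UNIV" "is_subring R3" "integrally_closed_in R3 UNIV" "{x, y, z} \<union> K \<subseteq> R3"
proof -
  note A = adjoin[OF K_subring, of z] and L0 = is_subfield_ratfun[OF K_subring, of z]
  have zm: "w\<^sup>2 + w \<in> adjoin K z" unfolding wz using is_subringD(7)[OF A(1) A(3)] .
  show 1: "artin_schreier (ratfun K z) w"
  proof
    show "w \<notin> ratfun K z"
      using ord_notin[OF ord_set_ratfun ord_w _ not_dvd(1)] by auto
  qed (use char2 L0 zm in auto)
  interpret AS1: artin_schreier "ratfun K z" w by (rule 1)
  have L1: "is_subfield L1" unfolding L1_def by (rule AS1.is_subfield_qext)
  have R1: "is_subring R1" unfolding R1_def using A(1) zm by (rule is_subring_qext)
  note S1 = qext_superset[OF A(1), of w, folded R1_def]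
  have ym: "y\<^sup>2 + y \<in> R1" unfolding w_def[symmetric] using S1 by auto
  have RL1: "R1 \<subseteq> L1"
    unfolding R1_def using L0 qext_superset[OF is_subfieldD(1)[OF L0(1)], of w] L1
    by (intro qext_subset) (auto simp: L1_def is_subfieldD)
  show 2: "artin_schreier L1 y"
  proof
    show "y \<notin> L1" using ord_notin[OF ord_sets(1) ord_y _ not_dvd(2)] by auto
  qed (use char2 L1 RL1 ym in auto)
  interpret AS2: artin_schreier L1 y by (rule 2)
  have L2: "is_subfield L2" unfolding L2_def by (rule AS2.is_subfield_qext)
  have R2: "is_subring R2" unfolding R2_def using R1 ym by (rule is_subring_qext)
  note S2 = qext_superset[OF R1, of y, folded R2_def]
  have xm: "x\<^sup>2 + x \<in> R2" unfolding xy using S2(2) is_subringD(7)[OF R2] by auto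
  have RL2: "R2 \<subseteq> L2"
    unfolding R2_def using RL1 qext_superset[OF is_subfieldD(1)[OF L1], of y] L2
    by (intro qext_subset) (auto simp: L2_def is_subfieldD)
  show 3: "artin_schreier L2 x"
  proof
    show "x \<notin> L2" using ord_notin[OF ord_sets(2) ord_x _ not_dvd(3)] by auto
  qed (use char2 L2 RL2 xm in auto)
  interpret AS3: artin_schreier L2 x by (rule 3)
  have L3: "is_subfield L3" unfolding L3_def by (rule AS3.is_subfield_qext)
  show R3: "is_subring R3" unfolding R3_def using R2 xm by (rule is_subring_qext)
  note S3 = qext_superset[OF R2, of x, folded R3_def]
  show gens: "{x, y, z} \<union> K \<subseteq> R3" using A S1 S2 S3 by auto
  have "R3 \<subseteq> L3"
    unfolding R3_def using RL2 qext_superset[OF is_subfieldD(1)[OF L2], of x] L3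
    by (intro qext_subset) (auto simp: L3_def is_subfieldD)
  then have "is_subfield hull (K \<union> {x, y, z}) \<subseteq> L3"
    using gens L3 by (intro hull_minimal) auto
  then show "L3 = UNIV" using gen by auto
  have "integrally_closed_in R1 L1"
    unfolding R1_def L1_def
    by (intro AS1.integrally_closed_in_qext A L0 zm integrally_closed_in_ratfun K z)
  then have "integrally_closed_in R2 L2"
    unfolding R2_def L2_def by (intro AS2.integrally_closed_in_qext R1 RL1 ym)
  then have "integrally_closed_in R3 L3"
    unfolding R3_def L3_def by (intro AS3.integrally_closed_in_qext R2 RL2 xm)
  then show "integrally_closed_in R3 UNIV" using \<open>L3 = UNIV\<close> by simp
qed

lemma ord_set_UNIV: "ord_set UNIV UNIV"
  using ord_sets(3) tower(4) by simp

text \<open>Membership in a place at infinity is decided by the sign of the order, which is common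
  to all of these places.\<close>

lemma infinity_singleton:
  assumes P: "P \<in> infinity"
  shows "infinity = {P}"
proof -
  have "Q = P" if Q: "Q \<in> infinity" for Q
  proof -
    have "f \<in> Q \<longleftrightarrow> f \<in> P" for f
    proof (cases "f = 0")
      case True
      then show ?thesis using is_subringD(1)[OF Pc] P Q by auto
    next
      case False
      then obtain k where "ord_at f k" using ord_set_UNIV by (auto simp: ord_set_def)
      then show ?thesis using ord_in_iff P Q by blast
    qed
    then show ?thesis by auto
  qed
  then show ?thesis using P by blast
qed

text \<open>\<open>R3\<close> is the intersection of the valuation rings above it. Apart from the
  whole field, these are exactly the places other than \<open>P\<close>.\<close>

lemma pole_only_at_infinity:
  assumes P: "P \<in> infinity"
  shows "(\<forall>Q. is_place K Q \<and> Q \<noteq> P \<longrightarrow> f \<in> Q) \<longleftrightarrow> f \<in> R3"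
proof
  assume f: "\<forall>Q. is_place K Q \<and> Q \<noteq> P \<longrightarrow> f \<in> Q"
  have "f \<in> V" if V: "val_ring V" "R3 \<subseteq> V" for V
  proof (cases "V = UNIV")
    case False
    have "K \<subset> V" using V(2) tower(7) z_notin_K by auto
    then have "is_place K V"
      using V(1) False by (auto simp: is_place_def val_ring_def is_subring_def)
    moreover have "V \<noteq> P" using V(2) tower(7) not_integral_at_infinity[OF P] by auto
    ultimately show ?thesis using f by blast
  qed simp
  then show "f \<in> R3" using tower(6) by (auto simp: integrally_closed_in_def)
next
  assume f: "f \<in> R3"
  show "\<forall>Q. is_place K Q \<and> Q \<noteq> P \<longrightarrow> f \<in> Q"
  proof (intro allI impI)
    fix Q assume Q: "is_place K Q \<and> Q \<noteq> P"
    then have V: "val_ring Q" "K \<subseteq> Q" using place_val_ring by auto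
    note c = is_subringD[OF val_ringD(1)[OF V(1)]]
    have "Q \<notin> infinity" using infinity_singleton[OF P] Q by auto
    then have xyz: "{x, y, z} \<subseteq> Q" using Q by (auto simp: infinity_def is_place_at_infinity_def)
    have "w \<in> Q" unfolding w_def using xyz by (intro c) auto
    note sub = qext_subset[OF val_ringD(1)[OF V(1)]]
    have "adjoin K z \<subseteq> Q" using V xyz val_ringD(1) by (intro adjoin_subset) auto
    then have "R3 \<subseteq> Q"
      unfolding R3_def R2_def R1_def using \<open>w \<in> Q\<close> xyz by (intro sub) auto
    then show "f \<in> Q" using f by auto
  qed
qed

lemma weierstrass_semigroup_eq:
  assumes P: "P \<in> infinity"
  shows "weierstrass_semigroup K P = ggs_semigroup m"
proof -
  note val = place_val_eq[OF ord_set_UNIV infinity_singleton[OF P]]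
  have div: "has_pole_divisor K f r P \<longleftrightarrow> f \<noteq> 0 \<and> f \<in> R3 \<and> int r = max 0 (- place_val P f)" for f r
    unfolding has_pole_divisor_def pole_only_at_infinity[OF P] ..
  show ?thesis
  proof (intro equalityI subsetI)
    fix r assume "r \<in> weierstrass_semigroup K P"
    then obtain f where f: "f \<noteq> 0" "f \<in> R3" "int r = max 0 (- place_val P f)"
      by (auto simp: weierstrass_semigroup_def div)
    then obtain k where k: "k \<in> pole_orders m multipliers" "ord_at f k"
      using ord_sets(6) unfolding ord_set_def multipliers_def by blast
    then obtain u j where u: "u \<in> multipliers" "k = - int (u * m + 8 * j)"
      unfolding pole_orders_def by blast
    have "int r = int (u * m + 8 * j)" using f(3) val[OF k(2)] u(2) by simp
    then have "r = u * m + 8 * j" by (simp only: of_nat_eq_iff)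
    then show "r \<in> ggs_semigroup m" using u(1) unfolding ggs_semigroup_def by blast
  next
    fix r assume "r \<in> ggs_semigroup m"
    then obtain u j where u: "u \<in> multipliers" "r = u * m + 8 * j"
      unfolding ggs_semigroup_def by blast
    \<comment> \<open>The parity of \<open>u\<close> gives the exponent of \<open>x\<close>; odd
      multipliers are at least \<open>3\<close>, so the subtraction is not truncated.\<close>
    define i l where "i = u mod 2" and "l = (u - 3 * (u mod 2)) div 2"
    have il: "u = 3 * i + 2 * l" unfolding i_def l_def using u(1) by (auto simp: multipliers_def)
    define f where "f = x ^ i * y ^ l * z ^ j"
    have "ord_at f (int i * - int (3 * m) + int l * - int (2 * m) + int j * - 8)"
      unfolding f_def by (intro ord_mult ord_power ord_x ord_y ord_z)
    then have f: "ord_at f (- int r)" by (simp add: u il algebra_simps)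
    have "f \<in> R3" unfolding f_def using tower(7) by (intro is_subringD[OF tower(5)]) auto
    then have "has_pole_divisor K f r P" using ord_nonzero[OF f] val[OF f] by (simp add: div)
    then show "r \<in> weierstrass_semigroup K P" by (auto simp: weierstrass_semigroup_def)
  qed
qed

end

end

section \<open>The order bound\<close>

text \<open>This is \<open>nu\<close> as a function of the element instead of its index.\<close>

definition pair_count :: "nat set \<Rightarrow> nat \<Rightarrow> nat" where
  "pair_count H s = card {(a, b). a \<in> H \<and> b \<in> H \<and> a + b = s}"

section \<open>Splittings counted by class modulo 8\<close>

lemma ggs_semigroup_iff:
  "s \<in> ggs_semigroup m \<longleftrightarrow> (\<exists>u\<in>multipliers. \<exists>k. s = u * m + 8 * k)"
  unfolding ggs_semigroup_def by blast

text \<open>Modulo \<open>8\<close> the odd number \<open>m\<close> is invertible and the eight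
  multipliers are distinct.\<close>

lemma multipliers_unique:
  assumes "u \<in> multipliers" "v \<in> multipliers" "odd m" "u * m + 8 * c = v * m + 8 * d"
  shows "u = v"
proof -
  have "int (u * m + 8 * c) = int (v * m + 8 * d)" using assms(4) by (simp only:)
  then have "(int u - int v) * int m = 8 * (int d - int c)" by (simp add: algebra_simps)
  then have "8 dvd (int u - int v) * int m" by simp
  moreover have "coprime (2 ^ 3) (int m)" using \<open>odd m\<close> by (subst coprime_power_left_iff) simp
  ultimately have "8 dvd int u - int v" by (simp add: coprime_dvd_mult_left_iff)
  with assms(1,2) show ?thesis
    unfolding multipliers_def by (elim insertE emptyE) simp_all
qed

text \<open>
  In the splitting \<open>(q m + 8 c) = a + b\<close>, the class of \<open>a\<close> modulo \<open>8\<close> is given by a multiplier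
  \<open>u\<close>, which determines the multiplier \<open>q + 8 e - u\<close> of \<open>b\<close>, where \<open>e = carry q u\<close>.
\<close>

definition carry :: "nat \<Rightarrow> nat \<Rightarrow> nat" where
  "carry q u = (if u \<le> q \<and> q - u \<in> multipliers then 0
    else if u \<le> q + 8 \<and> q + 8 - u \<in> multipliers then 1 else 2)"

lemma carry:
  assumes "q \<in> multipliers" "u \<in> multipliers"
  shows "u \<le> q + 8 * carry q u" "q + 8 * carry q u - u \<in> multipliers"
  using assms[unfolded multipliers_def]
  by (elim insertE emptyE; simp add: carry_def multipliers_def)+

text \<open>The class of the difference modulo \<open>8\<close> fixes its multiplier
  \<open>v\<close>, and \<open>u * m + v * m\<close> exceeds \<open>q * m\<close> by
  \<open>8 * carry q u * m\<close>. What remains for the second summand is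
  \<open>c - k - carry q u * m\<close>.\<close>

lemma splitting_iff:
  assumes "odd m" "q \<in> multipliers" "u \<in> multipliers"
  shows "(u * m + 8 * k \<le> q * m + 8 * c \<and> q * m + 8 * c - (u * m + 8 * k) \<in> ggs_semigroup m)
    \<longleftrightarrow> k + carry q u * m \<le> c"
proof -
  define v where "v = q + 8 * carry q u - u"
  have v: "v \<in> multipliers" "u + v = q + 8 * carry q u"
    using carry[OF assms(2,3)] by (auto simp: v_def)
  then have sum: "u * m + v * m = q * m + 8 * (carry q u * m)"
    by (metis distrib_right mult.assoc)
  show ?thesis
  proof
    assume "k + carry q u * m \<le> c"
    then obtain j where "c = k + carry q u * m + j" using le_Suc_ex by blast
    then have "q * m + 8 * c = (u * m + 8 * k) + (v * m + 8 * j)" using sum by simp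
    then show "u * m + 8 * k \<le> q * m + 8 * c \<and>
        q * m + 8 * c - (u * m + 8 * k) \<in> ggs_semigroup m"
      using v(1) unfolding ggs_semigroup_iff by auto
  next
    assume "u * m + 8 * k \<le> q * m + 8 * c \<and>
        q * m + 8 * c - (u * m + 8 * k) \<in> ggs_semigroup m"
    then obtain v' j where v': "v' \<in> multipliers" "q * m + 8 * c = (u * m + 8 * k) + (v' * m + 8 * j)"
      unfolding ggs_semigroup_iff by (metis le_add_diff_inverse)
    have "v * m + 8 * c = v' * m + 8 * (k + j + carry q u * m)"
      using sum v'(2) by simp
    then have "v = v'" using multipliers_unique[OF v(1) v'(1) \<open>odd m\<close>] by blast
    then show "k + carry q u * m \<le> c" using sum v'(2) by simp
  qed
qed

text \<open>A pair is determined by its first entry \<open>u * m + 8 * k\<close>. The truncated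
  difference is the number of admissible \<open>k\<close>, and is \<open>0\<close> if there are
  none.\<close>

lemma pair_count_eq:
  assumes "odd m" "q \<in> multipliers"
  shows "pair_count (ggs_semigroup m) (q * m + 8 * c)
    = (\<Sum>u\<in>multipliers. c + 1 - carry q u * m)"
proof -
  let ?H = "ggs_semigroup m" and ?s = "q * m + 8 * c"
  define T where "T u = {k. k + carry q u * m \<le> c}" for u
  have T: "T u = {..<c + 1 - carry q u * m}" for u unfolding T_def by auto
  have "bij_betw (\<lambda>(u, k). (u * m + 8 * k, ?s - (u * m + 8 * k)))
      (Sigma multipliers T) {(a, b). a \<in> ?H \<and> b \<in> ?H \<and> a + b = ?s}"
    unfolding bij_betw_def
  proof
    show "inj_on (\<lambda>(u, k). (u * m + 8 * k, ?s - (u * m + 8 * k))) (Sigma multipliers T)"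
    proof (rule inj_onI, clarsimp)
      fix u k u' k' assume *: "u \<in> multipliers" "u' \<in> multipliers" "u * m + 8 * k = u' * m + 8 * k'"
      then have "u = u'"
        using multipliers_unique[OF *(1,2) \<open>odd m\<close>] by blast
      then show "u = u' \<and> k = k'" using *(3) by simp
    qed
    show "(\<lambda>(u, k). (u * m + 8 * k, ?s - (u * m + 8 * k))) ` Sigma multipliers T
        = {(a, b). a \<in> ?H \<and> b \<in> ?H \<and> a + b = ?s}" (is "?f ` _ = ?R")
    proof (intro equalityI subsetI)
      fix p assume "p \<in> ?f ` Sigma multipliers T"
      then obtain u k where *: "u \<in> multipliers" "k + carry q u * m \<le> c"
        "p = (u * m + 8 * k, ?s - (u * m + 8 * k))" by (auto simp: T_def)
      then show "p \<in> ?R"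
        using splitting_iff[OF assms *(1), of k c] by (auto simp: ggs_semigroup_iff)
    next
      fix p assume "p \<in> ?R"
      then obtain a b where p: "p = (a, b)" "a \<in> ?H" "b \<in> ?H" "a + b = ?s" by auto
      then obtain u k where u: "u \<in> multipliers" "a = u * m + 8 * k"
        unfolding ggs_semigroup_iff by auto
      have b: "b = ?s - (u * m + 8 * k)" "u * m + 8 * k \<le> ?s" using p u(2) by auto
      then have "k \<in> T u"
        using splitting_iff[OF assms u(1), of k c] p(3) by (auto simp: T_def)
      then show "p \<in> ?f ` Sigma multipliers T"
        using u p(1) b(1) by (auto intro!: image_eqI[of _ _ "(u, k)"])
    qed
  qed
  then have "pair_count ?H ?s = card (Sigma multipliers T)"
    unfolding pair_count_def by (simp add: bij_betw_same_card)
  also have "\<dots> = (\<Sum>u\<in>multipliers. card (T u))"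
    by (intro card_SigmaI) (auto simp: multipliers_def T)
  finally show ?thesis by (simp add: T)
qed

text \<open>Each row sorts the multipliers \<open>u\<close> by their carry. Carry \<open>2\<close>
  comes only from the sums \<open>7 + 9\<close> and \<open>9 + 9\<close>, hence only in the first
  two rows.\<close>

lemma sum_carry:
  fixes f :: "nat \<Rightarrow> nat"
  shows
    "(\<Sum>u\<in>multipliers. f (carry 0 u)) = f 0 + 5 * f 1 + 2 * f 2"
    "(\<Sum>u\<in>multipliers. f (carry 2 u)) = 2 * f 0 + 5 * f 1 + f 2"
    "(\<Sum>u\<in>multipliers. f (carry 3 u)) = 2 * f 0 + 6 * f 1"
    "(\<Sum>u\<in>multipliers. f (carry 4 u)) = 3 * f 0 + 5 * f 1"
    "(\<Sum>u\<in>multipliers. f (carry 5 u)) = 4 * f 0 + 4 * f 1"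
    "(\<Sum>u\<in>multipliers. f (carry 6 u)) = 5 * f 0 + 3 * f 1"
    "(\<Sum>u\<in>multipliers. f (carry 7 u)) = 6 * f 0 + 2 * f 1"
    "(\<Sum>u\<in>multipliers. f (carry 9 u)) = 8 * f 0"
  by (simp_all add: multipliers_def carry_def)

lemma pair_counts:
  assumes "odd m"
  shows
    "pair_count (ggs_semigroup m) (8 * c) = (c + 1) + 5 * (c + 1 - m) + 2 * (c + 1 - 2 * m)"
    "pair_count (ggs_semigroup m) (2 * m + 8 * c) = 2 * (c + 1) + 5 * (c + 1 - m) + (c + 1 - 2 * m)"
    "pair_count (ggs_semigroup m) (3 * m + 8 * c) = 2 * (c + 1) + 6 * (c + 1 - m)"
    "pair_count (ggs_semigroup m) (4 * m + 8 * c) = 3 * (c + 1) + 5 * (c + 1 - m)"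
    "pair_count (ggs_semigroup m) (5 * m + 8 * c) = 4 * (c + 1) + 4 * (c + 1 - m)"
    "pair_count (ggs_semigroup m) (6 * m + 8 * c) = 5 * (c + 1) + 3 * (c + 1 - m)"
    "pair_count (ggs_semigroup m) (7 * m + 8 * c) = 6 * (c + 1) + 2 * (c + 1 - m)"
    "pair_count (ggs_semigroup m) (9 * m + 8 * c) = 8 * (c + 1)"
proof -
  define f where "f = (\<lambda>e. c + 1 - e * m)"
  have pc: "pair_count (ggs_semigroup m) (q * m + 8 * c) = (\<Sum>u\<in>multipliers. f (carry q u))"
    if "q \<in> multipliers" for q
    using pair_count_eq[OF assms that] by (simp add: f_def)
  have mem: "0 \<in> multipliers" "2 \<in> multipliers" "3 \<in> multipliers" "4 \<in> multipliers"
    "5 \<in> multipliers" "6 \<in> multipliers" "7 \<in> multipliers" "9 \<in> multipliers"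
    by (simp_all add: multipliers_def)
  show "pair_count (ggs_semigroup m) (8 * c) = (c + 1) + 5 * (c + 1 - m) + 2 * (c + 1 - 2 * m)"
    using pc[of 0] unfolding sum_carry by (simp add: mem f_def)
  show "pair_count (ggs_semigroup m) (2 * m + 8 * c) = 2 * (c + 1) + 5 * (c + 1 - m) + (c + 1 - 2 * m)"
    using pc[of 2] unfolding sum_carry by (simp add: mem f_def)
  show "pair_count (ggs_semigroup m) (3 * m + 8 * c) = 2 * (c + 1) + 6 * (c + 1 - m)"
    using pc[of 3] unfolding sum_carry by (simp add: mem f_def)
  show "pair_count (ggs_semigroup m) (4 * m + 8 * c) = 3 * (c + 1) + 5 * (c + 1 - m)"
    using pc[of 4] unfolding sum_carry by (simp add: mem f_def)
  show "pair_count (ggs_semigroup m) (5 * m + 8 * c) = 4 * (c + 1) + 4 * (c + 1 - m)"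
    using pc[of 5] unfolding sum_carry by (simp add: mem f_def)
  show "pair_count (ggs_semigroup m) (6 * m + 8 * c) = 5 * (c + 1) + 3 * (c + 1 - m)"
    using pc[of 6] unfolding sum_carry by (simp add: mem f_def)
  show "pair_count (ggs_semigroup m) (7 * m + 8 * c) = 6 * (c + 1) + 2 * (c + 1 - m)"
    using pc[of 7] unfolding sum_carry by (simp add: mem f_def)
  show "pair_count (ggs_semigroup m) (9 * m + 8 * c) = 8 * (c + 1)"
    using pc[of 9] unfolding sum_carry by (simp add: mem f_def)
qed

section \<open>From the counts to the order bound\<close>

lemma d_ORD_eq:
  assumes H: "weierstrass_semigroup K P = H" "infinite H"
    and s: "s \<in> H" "rho H (l + 1) \<le> s"
    and le: "\<And>s'. s' \<in> H \<Longrightarrow> rho H (l + 1) \<le> s' \<Longrightarrow> pair_count H s \<le> pair_count H s'"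
  shows "d_ORD K P l = pair_count H s"
proof -
  \<comment> \<open>The shift by one in \<open>nu\<close> and the indexing of \<open>rho\<close>
    from \<open>1\<close> cancel.\<close>
  have nu: "nu H r = pair_count H (enumerate H r)" for r
    by (simp add: nu_def pair_count_def rho_def)
  \<comment> \<open>By monotonicity the indices \<open>r \<ge> l\<close> correspond to the elements
    from \<open>rho H (l + 1)\<close> on, so the minimum may be taken over elements.\<close>
  have mono: "enumerate H i \<le> enumerate H j \<longleftrightarrow> i \<le> j" for i j
    using H(2) by (meson enumerate_mono_le_iff)
  obtain r where r: "enumerate H r = s" using enumerate_Ex[OF H(2) s(1)] by auto
  show ?thesis
    unfolding d_ORD_def H(1)
  proof (rule cInf_eq_minimum)
    show "pair_count H s \<in> {nu H r | r. r \<ge> l}"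
      using r s(2) mono by (auto simp: nu rho_def)
    fix c assume "c \<in> {nu H r | r. r \<ge> l}"
    then obtain r' where "c = pair_count H (enumerate H r')" "l \<le> r'" by (auto simp: nu)
    then show "pair_count H s \<le> c"
      using le[OF enumerate_in_set[OF H(2), of r']] mono by (auto simp: rho_def)
  qed
qed

lemma infinite_ggs_semigroup: "infinite (ggs_semigroup m)"
proof -
  have "inj (\<lambda>k. 8 * k :: nat)" by (auto intro: injI)
  then have "infinite (range (\<lambda>k. 8 * k :: nat))" using finite_imageD by blast
  moreover have "range (\<lambda>k. 8 * k) \<subseteq> ggs_semigroup m"
    by (force simp: ggs_semigroup_iff multipliers_def)
  ultimately show ?thesis using infinite_super by blast
qed

text \<open>Writing \<open>m = 8 h + 3\<close> turns the rounded fractions of \<open>m\<close> into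
  linear expressions in \<open>h\<close>. The minimum is attained at the first of
  \<open>3 m\<close>, ..., \<open>7 m\<close> in the range, or else at the first
  \<open>9 m + 8 c\<close>.\<close>

lemma d_ORD_ggs:
  fixes K P :: "'f::field set"
  assumes H: "weierstrass_semigroup K P = ggs_semigroup m" and m: "m = 8 * h + 3" "h \<ge> 1"
    and rho: "rho (ggs_semigroup m) (l + 1) = 2 * m + 8 * k" and "k < m"
  shows "8 * k \<le> m \<Longrightarrow> d_ORD K P l = 2"
    and "m \<le> 8 * k \<Longrightarrow> 8 * k \<le> 2 * m \<Longrightarrow> d_ORD K P l = 3"
    and "2 * m \<le> 8 * k \<Longrightarrow> 8 * k \<le> 3 * m \<Longrightarrow> d_ORD K P l = 4"
    and "3 * m \<le> 8 * k \<Longrightarrow> 8 * k \<le> 4 * m \<Longrightarrow> d_ORD K P l = 5"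
    and "4 * m \<le> 8 * k \<Longrightarrow> 8 * k \<le> 5 * m \<Longrightarrow> d_ORD K P l = 6"
    and "5 * m \<le> 8 * k \<Longrightarrow> d_ORD K P l = 8 * (k - (7 * h + 2) + 1)"
proof -
  have "odd m" using m by simp
  note pc = pair_counts[OF this]
  \<comment> \<open>The bound \<open>d\<close> is checked class by class. An element
    \<open>u m + 8 c\<close> lies in the range iff \<open>k - c\<close> is at most
    \<open>(u - 2) m / 8\<close>, rounded down in terms of \<open>h\<close>. In classes
    \<open>0\<close> and \<open>2\<close> a part of the count is enough.\<close>
  have min: "d_ORD K P l = d"
    if q: "q \<in> multipliers" "2 * m + 8 * k \<le> q * m + 8 * c"
      and d: "pair_count (ggs_semigroup m) (q * m + 8 * c) = d"
      and le: "\<And>c. 2 * h + k + 1 \<le> c \<Longrightarrow> d \<le> (c + 1) + 5 * (c + 1 - m)"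
        "\<And>c. k \<le> c \<Longrightarrow> d \<le> 2 * (c + 1)"
        "\<And>c. k \<le> h + c \<Longrightarrow> d \<le> 2 * (c + 1) + 6 * (c + 1 - m)"
        "\<And>c. k \<le> 2 * h + c \<Longrightarrow> d \<le> 3 * (c + 1) + 5 * (c + 1 - m)"
        "\<And>c. k \<le> 3 * h + 1 + c \<Longrightarrow> d \<le> 4 * (c + 1) + 4 * (c + 1 - m)"
        "\<And>c. k \<le> 4 * h + 1 + c \<Longrightarrow> d \<le> 5 * (c + 1) + 3 * (c + 1 - m)"
        "\<And>c. k \<le> 5 * h + 1 + c \<Longrightarrow> d \<le> 6 * (c + 1) + 2 * (c + 1 - m)"
        "\<And>c. k \<le> 7 * h + 2 + c \<Longrightarrow> d \<le> 8 * (c + 1)"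
    for q c d
  proof -
    have "d_ORD K P l = pair_count (ggs_semigroup m) (q * m + 8 * c)"
    proof (rule d_ORD_eq[OF H infinite_ggs_semigroup])
      show "q * m + 8 * c \<in> ggs_semigroup m" using q(1) by (auto simp: ggs_semigroup_iff)
      show "rho (ggs_semigroup m) (l + 1) \<le> q * m + 8 * c" using q(2) rho by simp
      fix s assume "s \<in> ggs_semigroup m" and s: "rho (ggs_semigroup m) (l + 1) \<le> s"
      then obtain u c' where "u \<in> multipliers" and u: "s = u * m + 8 * c'"
        by (auto simp: ggs_semigroup_iff)
      then consider "s = 8 * c'" | "s = 2 * m + 8 * c'" | "s = 3 * m + 8 * c'" | "s = 4 * m + 8 * c'"
        | "s = 5 * m + 8 * c'" | "s = 6 * m + 8 * c'" | "s = 7 * m + 8 * c'" | "s = 9 * m + 8 * c'"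
        by (auto simp: multipliers_def)
      then have "d \<le> pair_count (ggs_semigroup m) s"
      proof cases
        case 1
        have "d \<le> (c' + 1) + 5 * (c' + 1 - m)"
          by (rule le(1)) (use s 1 rho m in linarith)
        then show ?thesis unfolding 1 pc by (rule trans_le_add1)
      next
        case 2
        have "d \<le> 2 * (c' + 1)"
          by (rule le(2)) (use s 2 rho m in linarith)
        then show ?thesis unfolding 2 pc by simp
      next
        case 3
        have "d \<le> 2 * (c' + 1) + 6 * (c' + 1 - m)"
          by (rule le(3)) (use s 3 rho m in linarith)
        then show ?thesis unfolding 3 pc .
      next
        case 4
        have "d \<le> 3 * (c' + 1) + 5 * (c' + 1 - m)"
          by (rule le(4)) (use s 4 rho m in linarith)
        then show ?thesis unfolding 4 pc .
      next
        case 5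
        have "d \<le> 4 * (c' + 1) + 4 * (c' + 1 - m)"
          by (rule le(5)) (use s 5 rho m in linarith)
        then show ?thesis unfolding 5 pc .
      next
        case 6
        have "d \<le> 5 * (c' + 1) + 3 * (c' + 1 - m)"
          by (rule le(6)) (use s 6 rho m in linarith)
        then show ?thesis unfolding 6 pc .
      next
        case 7
        have "d \<le> 6 * (c' + 1) + 2 * (c' + 1 - m)"
          by (rule le(7)) (use s 7 rho m in linarith)
        then show ?thesis unfolding 7 pc .
      next
        case 8
        have "d \<le> 8 * (c' + 1)"
          by (rule le(8)) (use s 8 rho m in linarith)
        then show ?thesis unfolding 8 pc .
      qed
      then show "pair_count (ggs_semigroup m) (q * m + 8 * c) \<le> pair_count (ggs_semigroup m) s"
        using d by simp
    qed
    then show ?thesis using d by simp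
  qed
  \<comment> \<open>\<open>3 m\<close> splits only as \<open>0 + 3 m\<close> and
    \<open>3 m + 0\<close>.\<close>
  show "d_ORD K P l = 2" if "8 * k \<le> m"
    using that pc(3)[of 0] m
    by (intro min[where q = 3 and c = 0]) (simp_all add: multipliers_def)
  show "d_ORD K P l = 3" if "m \<le> 8 * k" "8 * k \<le> 2 * m"
  proof -
    \<comment> \<open>As \<open>m\<close> is odd, \<open>8 k = m\<close> is impossible:
      \<open>3 m\<close> lies strictly below the range. The next three cases exclude
      \<open>4 m\<close>, \<open>5 m\<close> and \<open>6 m\<close> in the same way.\<close>
    have "h + 1 \<le> k" using that m by linarith
    then show ?thesis
      using that(2) pc(4)[of 0] m
      by (intro min[where q = 4 and c = 0]; (simp add: multipliers_def; fail)?; linarith)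
  qed
  show "d_ORD K P l = 4" if "2 * m \<le> 8 * k" "8 * k \<le> 3 * m"
  proof -
    have "2 * h + 1 \<le> k" using that m by linarith
    then show ?thesis
      using that(2) pc(5)[of 0] m
      by (intro min[where q = 5 and c = 0]; (simp add: multipliers_def; fail)?; linarith)
  qed
  show "d_ORD K P l = 5" if "3 * m \<le> 8 * k" "8 * k \<le> 4 * m"
  proof -
    have "3 * h + 2 \<le> k" using that m by linarith
    then show ?thesis
      using that(2) pc(6)[of 0] m
      by (intro min[where q = 6 and c = 0]; (simp add: multipliers_def; fail)?; linarith)
  qed
  show "d_ORD K P l = 6" if "4 * m \<le> 8 * k" "8 * k \<le> 5 * m"
  proof -
    have "4 * h + 2 \<le> k" using that m by linarith
    then show ?thesis
      using that(2) pc(7)[of 0] m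
      by (intro min[where q = 7 and c = 0]; (simp add: multipliers_def; fail)?; linarith)
  qed
  show "d_ORD K P l = 8 * (k - (7 * h + 2) + 1)" if "5 * m \<le> 8 * k"
  proof (cases "k \<le> 7 * h + 2")
    case True
    have k: "5 * h + 2 \<le> k" using that m by linarith
    have "d_ORD K P l = 8"
      using True k pc(8)[of 0] m
      by (intro min[where q = 9 and c = 0]; (simp add: multipliers_def; fail)?; linarith)
    then show ?thesis using True by simp
  next
    case False
    \<comment> \<open>\<open>9 m + 8 e\<close> is the first element of its class in the range. From
      \<open>k < m\<close> follows \<open>e \<le> h\<close>, which keeps the counts in the other
      classes at least \<open>8 (e + 1)\<close>.\<close>
    define e where "e = k - (7 * h + 2)"
    have k: "k = 7 * h + 2 + e" "e \<le> h" using False m \<open>k < m\<close> by (auto simp: e_def)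
    have "d_ORD K P l = 8 * (e + 1)"
      using k pc(8)[of e] m
      by (intro min[where q = 9 and c = e]; (simp add: multipliers_def; fail)?; linarith)
    then show ?thesis by (simp add: e_def)
  qed
qed

theorem lemma3p9:
  fixes n m l k :: nat
    and K P :: "'f::field set"
    and x y z :: 'f
  assumes "n \<ge> 5" and "odd n"
    and "real m = (2 ^ n + 1) / 3"
    and "GGS_function_field n K x y z"
    and "is_place_at_infinity K x y z P"
    and "l \<ge> 1"
    and "k < m"
    and "rho (weierstrass_semigroup K P) (l + 1) = 2 * m + 8 * k"
  shows
    "(int k \<le> \<lfloor>real m / 8\<rfloor> \<longrightarrow> d_ORD K P l = 2) \<and>
     (\<lceil>real m / 8\<rceil> \<le> int k \<and> int k \<le> \<lfloor>real m / 4\<rfloor> \<longrightarrow> d_ORD K P l = 3) \<and>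
     (\<lceil>real m / 4\<rceil> \<le> int k \<and> int k \<le> \<lfloor>3 * real m / 8\<rfloor> \<longrightarrow> d_ORD K P l = 4) \<and>
     (\<lceil>3 * real m / 8\<rceil> \<le> int k \<and> int k \<le> \<lfloor>real m / 2\<rfloor> \<longrightarrow> d_ORD K P l = 5) \<and>
     (\<lceil>real m / 2\<rceil> \<le> int k \<and> int k \<le> \<lfloor>5 * real m / 8\<rfloor> \<longrightarrow> d_ORD K P l = 6) \<and>
     (\<lceil>5 * real m / 8\<rceil> \<le> int k \<and> int k \<le> int m - 1 \<longrightarrow>
        int (d_ORD K P l) = 8 * (max 0 \<lceil>real k - 7 * real m / 8\<rceil> + 1))"
proof -
  have "real (3 * m) = real (2 ^ n + 1)" using assms(3) by simp
  then have m3: "3 * m = 2 ^ n + 1" by (simp only: of_nat_eq_iff)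
  interpret ggs_curve n m K x y z
    using assms(1,4) m3 by unfold_locales auto
  have P: "P \<in> infinity" using assms(5) by (simp add: infinity_def)
  then have H: "weierstrass_semigroup K P = ggs_semigroup m"
    by (intro weierstrass_semigroup_eq) auto
  have "(2::nat) ^ n = 32 * 2 ^ (n - 5)"
    using \<open>n \<ge> 5\<close> power_add[of "2::nat" 5 "n - 5"] by simp
  moreover have "(2::nat) ^ (n - 5) \<ge> 1" by simp
  ultimately obtain N :: nat where "3 * m = 32 * N + 1" "N \<ge> 1" using m3 by metis
  \<comment> \<open>From \<open>3 m = 32 N + 1\<close> follows \<open>96 N = 9 m - 3\<close>, which
    yields this explicit \<open>h\<close>.\<close>
  then have "m = 8 * (12 * N - m) + 3" "12 * N - m \<ge> 1" by simp_all
  then obtain h where h: "m = 8 * h + 3" "h \<ge> 1" by blast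
  note d = d_ORD_ggs[OF H h assms(8)[unfolded H] \<open>k < m\<close>]
  have c: "max 0 \<lceil>real k - 7 * real m / 8\<rceil> = int (k - (7 * h + 2))"
  proof -
    \<comment> \<open>\<open>7 m / 8 = 7 h + 21 / 8\<close>, and the ceiling of the difference
      rounds \<open>21 / 8\<close> down to \<open>2\<close>. The maximum with \<open>0\<close>
      becomes truncated subtraction.\<close>
    have "\<lceil>real k - 7 * real m / 8\<rceil> = int k - (7 * int h + 2)"
      by (rule ceiling_unique) (simp_all add: h(1) field_simps)
    then show ?thesis by linarith
  qed
  show ?thesis
    unfolding le_floor_iff ceiling_le_iff c
    by (intro conjI impI) (simp_all add: d)
qed

end
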